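(* Let $n$ be a positive integer, $W\subseteq R_{(1,n)}$ a three-dimensional basepoint free subspace, and let $\beta_{1,(3,* )}$ be the number of minimal first syzygies of $I_W$ of bidegree $(3,m)$ for arbitrary $m$. Then $$\beta_{1,(3,* )}\in\{1,2,3,4,5\},$$ and all values between one and five occur: for each $k\in\{1,\dots,5\}$ there exist $n$ and such a $W$ with $\beta_{1,(3,* )}=k$.
   Context: $\mathbb K$ is a field, $R=\mathbb K[s,t;u,v]$ is $\mathbb Z^2$-graded with $\deg s=\deg t=(1,0)$, $\deg u=\deg v=(0,1)$. For $W=\operatorname{Span}\{f_0,f_1,f_2\}$, $I_W=\langle f_0,f_1,f_2\rangle$; $W$ is basepoint free if $\sqrt{I_W}=\langle s,t\rangle\cap\langle u,v\rangle$. The first syzygy module is $\operatorname{Syz}=\ker\big(R(-1,-n)^3\xrightarrow{(f_0,f_1,f_2)}R\big)$; a syzygy whose entries have bidegree $\mathbf e$ has bidegree $\mathbf e+(1,n)$. The number of minimal first syzygies of bidegree $\mathbf a$ is $\beta_{1,\mathbf a}=\dim_{\mathbb K}(\operatorname{Syz}/\mathfrak m\operatorname{Syz})_{\mathbf a}=\dim_{\mathbb K}\operatorname{Tor}_1^R(I_W,\mathbb K)_{\mathbf a}$, $\mathfrak m=\langle s,t,u,v\rangle$, and $\beta_{1,(3,* )}=\sum_m\beta_{1,(3,m)}$. *)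

theory Defs
  imports
    "HOL-Analysis.Cartesian_Space"
    "HOL-Library.Poly_Mapping"
    "HOL-Library.Groups_Big_Fun"
begin

datatype var = Var_s | Var_t | Var_u | Var_v

text \<open>Monomials are exponent vectors, so that the type below is $K[s,t;u,v]$ with its usual ring
  structure (convolution product, provided by \<^theory>\<open>HOL-Library.Poly_Mapping\<close>).\<close>

type_synonym 'k bipoly = "(var \<Rightarrow>\<^sub>0 nat) \<Rightarrow>\<^sub>0 'k"

definition Var :: "var \<Rightarrow> 'k::field bipoly" where
  "Var i = Poly_Mapping.single (Poly_Mapping.single i 1) 1"

definition Const :: "'k::field \<Rightarrow> 'k bipoly" where
  "Const c = Poly_Mapping.single 0 c"

text \<open>The grading is by all of $Z^2$; pieces with a negative component are zero.\<close>

definition graded_part :: "int \<times> int \<Rightarrow> 'k::field bipoly set" where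
  "graded_part a = {p. \<forall>m \<in> Poly_Mapping.keys p.
     int (Poly_Mapping.lookup m Var_s + Poly_Mapping.lookup m Var_t) = fst a \<and>
     int (Poly_Mapping.lookup m Var_u + Poly_Mapping.lookup m Var_v) = snd a}"

definition scale_poly :: "'k::field \<Rightarrow> 'k bipoly \<Rightarrow> 'k bipoly" where
  "scale_poly c p = Const c * p"

definition scale_vec :: "'k::field \<Rightarrow> 'k bipoly ^ 3 \<Rightarrow> 'k bipoly ^ 3" where
  "scale_vec c g = Const c *s g"

text \<open>\<open>quotient_dim U V\<close> is the dimension of the image of the subspace \<open>V\<close> in the quotient of
  the ambient space by the subspace \<open>U\<close>. A basis of that image is given by
  representatives in \<open>V\<close>: the classes of the elements of \<open>B\<close> generate it, and no nontrivial
  combination of them vanishes (so the classes are distinct as well). As for the library's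
  \<^const>\<open>vector_space.dim\<close>, the cardinality is that of some basis, and 0 if it is infinite.\<close>

definition (in vector_space) quotient_basis :: "'b set \<Rightarrow> 'b set \<Rightarrow> 'b set \<Rightarrow> bool" where
  "quotient_basis U V B \<longleftrightarrow> B \<subseteq> V \<and>
     (\<forall>x\<in>V. \<exists>y\<in>span B. x - y \<in> U) \<and>
     (\<forall>F c. finite F \<and> F \<subseteq> B \<and> (\<Sum>b\<in>F. scale (c b) b) \<in> U \<longrightarrow> (\<forall>b\<in>F. c b = 0))"

definition (in vector_space) quotient_dim :: "'b set \<Rightarrow> 'b set \<Rightarrow> nat" where
  "quotient_dim U V = card (SOME B. quotient_basis U V B)"

lemma (in vector_space) quotient_basis_card_le:
  assumes U: "subspace U" and B: "quotient_basis U V B" and C: "quotient_basis U V C"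
    and fin: "finite C"
  shows "finite B \<and> card B \<le> card C"
proof -
  have "B \<subseteq> V" "\<forall>x\<in>V. \<exists>y\<in>span C. x - y \<in> U"
    using B[unfolded quotient_basis_def, THEN conjunct1]
      C[unfolded quotient_basis_def, THEN conjunct2, THEN conjunct1] by -
  then have "\<forall>b\<in>B. \<exists>y\<in>span C. b - y \<in> U"
    by (meson subsetD)
  then obtain h where h: "\<And>b. b \<in> B \<Longrightarrow> h b \<in> span C" "\<And>b. b \<in> B \<Longrightarrow> b - h b \<in> U"
    by metis
  have key: "\<forall>b\<in>F. c b = 0" if F: "finite F" "F \<subseteq> B" and 0: "(\<Sum>b\<in>F. scale (c b) (h b)) = 0" for F c
  proof -
    have "(\<Sum>b\<in>F. scale (c b) b) = (\<Sum>b\<in>F. scale (c b) (b - h b))"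
      using 0 by (simp add: scale_right_diff_distrib sum_subtractf)
    also have "\<dots> \<in> U"
      using F h U by (intro subspace_sum subspace_scale) auto
    finally show ?thesis
      using B F unfolding quotient_basis_def by blast
  qed
  have inj: "inj_on h B"
  proof (rule inj_onI, rule ccontr)
    fix x y assume xy: "x \<in> B" "y \<in> B" "h x = h y" "x \<noteq> y"
    have "\<forall>b\<in>{x, y}. (if b = x then 1 else - 1 :: 'a) = 0"
      by (rule key) (use xy in auto)
    then show False by simp
  qed
  have "independent (h ` B)"
    unfolding dependent_explicit
  proof clarify
    fix t u v assume t: "finite t" "t \<subseteq> h ` B" "(\<Sum>v\<in>t. scale (u v) v) = 0" "v \<in> t" "u v \<noteq> 0"
    from t obtain F where F: "F \<subseteq> B" "finite F" "t = h ` F"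
      by (meson finite_subset_image)
    have "(\<Sum>b\<in>F. scale (u (h b)) (h b)) = 0"
      using t(3) F inj by (simp add: sum.reindex inj_on_subset)
    from key[OF F(2) F(1) this] show False
      using t F by auto
  qed
  moreover have "h ` B \<subseteq> span C"
    using h by auto
  ultimately have "finite (h ` B) \<and> card (h ` B) \<le> card C"
    using independent_span_bound[OF fin] by blast
  then show ?thesis
    using inj by (simp add: card_image finite_image_iff)
qed

lemma (in vector_space) quotient_dim_eq_card:
  assumes "subspace U" "quotient_basis U V B"
  shows "quotient_dim U V = card B"
proof -
  define C where "C = (SOME B. quotient_basis U V B)"
  have C: "quotient_basis U V C"
    unfolding C_def using assms(2) by (rule someI)
  note le = quotient_basis_card_le[OF assms(1)]
  have "card C = card B"
  proof (cases "finite B")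
    case True
    then have "finite C" "card C \<le> card B" using le[OF C assms(2)] by blast+
    then show ?thesis using le[OF assms(2) C] by linarith
  next
    case False
    then have "infinite C" using le[OF assms(2) C] by blast
    then show ?thesis using False by simp
  qed
  then show ?thesis
    by (simp only: quotient_dim_def C_def)
qed

lemma Const_simps:
  "Const (a + b) = Const a + Const b" "Const (a * b) = Const a * Const b" "Const 1 = 1"
  by (simp_all add: Const_def single_add mult_single)

interpretation ring_module: module "(*) :: 'k::field bipoly \<Rightarrow> 'k bipoly \<Rightarrow> 'k bipoly"
  by unfold_locales (simp_all only: distrib_left distrib_right mult.assoc mult_1_left)

interpretation free_module: module "(*s) :: 'k::field bipoly \<Rightarrow> 'k bipoly ^ 3 \<Rightarrow> 'k bipoly ^ 3"
  by unfold_locales (simp_all only: vec_eq_iff vector_smult_component vector_add_component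
    distrib_left distrib_right mult.assoc mult_1_left simp_thms)

interpretation poly_space: vector_space "scale_poly :: 'k::field \<Rightarrow> 'k bipoly \<Rightarrow> 'k bipoly"
  by unfold_locales
    (simp_all only: scale_poly_def Const_simps distrib_left distrib_right mult.assoc mult_1_left)

interpretation vec_space: vector_space "scale_vec :: 'k::field \<Rightarrow> 'k bipoly ^ 3 \<Rightarrow> 'k bipoly ^ 3"
  by unfold_locales
    (simp_all only: scale_vec_def Const_simps free_module.scale_right_distrib
      free_module.scale_left_distrib free_module.scale_scale free_module.scale_one)

definition ideal_gen :: "'k::field bipoly set \<Rightarrow> 'k bipoly set" where
  "ideal_gen A = ring_module.span A"

definition radical :: "'k::field bipoly set \<Rightarrow> 'k bipoly set" where
  "radical I = {p. \<exists>k. p ^ k \<in> I}"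

text \<open>The three generators $f_0, f_1, f_2$ are the components of a vector \<open>f\<close>.\<close>

definition I_W :: "'k::field bipoly ^ 3 \<Rightarrow> 'k bipoly set" where
  "I_W f = ideal_gen (range (($) f))"

definition basepoint_free :: "'k::field bipoly ^ 3 \<Rightarrow> bool" where
  "basepoint_free f \<longleftrightarrow>
     radical (I_W f) = ideal_gen {Var Var_s, Var Var_t} \<inter> ideal_gen {Var Var_u, Var Var_v}"

definition irrelevant :: "'k::field bipoly set" where
  "irrelevant = ideal_gen {Var Var_s, Var Var_t, Var Var_u, Var Var_v}"

definition Syz :: "'k::field bipoly ^ 3 \<Rightarrow> ('k bipoly ^ 3) set" where
  "Syz f = {g. (\<Sum>i\<in>UNIV. g $ i * f $ i) = 0}"

definition m_Syz :: "'k::field bipoly ^ 3 \<Rightarrow> ('k bipoly ^ 3) set" where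
  "m_Syz f = free_module.span {x *s g | x g. x \<in> irrelevant \<and> g \<in> Syz f}"

text \<open>The source of the syzygy map is $R(-1,-n)^3$, whence the shift by \<open>(1, n)\<close>.\<close>

definition Syz_part :: "nat \<Rightarrow> 'k::field bipoly ^ 3 \<Rightarrow> int \<times> int \<Rightarrow> ('k bipoly ^ 3) set" where
  "Syz_part n f a = {g \<in> Syz f. \<forall>i. g $ i \<in> graded_part (fst a - 1, snd a - int n)}"

text \<open>The graded piece of $\mathrm{Syz}/m\,\mathrm{Syz}$ in bidegree \<open>a\<close> is the image of that
  piece of $\mathrm{Syz}$.\<close>

definition betti1 :: "nat \<Rightarrow> 'k::field bipoly ^ 3 \<Rightarrow> int \<times> int \<Rightarrow> nat" where
  "betti1 n f a = vec_space.quotient_dim (m_Syz f) (Syz_part n f a)"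

text \<open>\<^const>\<open>Sum_any\<close> sums over the support, and is 0 if the support is infinite.\<close>

definition betti1_3 :: "nat \<Rightarrow> 'k::field bipoly ^ 3 \<Rightarrow> nat" where
  "betti1_3 n f = Sum_any (\<lambda>m::int. betti1 n f (3, m))"

definition bpf_subspace ::
  "nat \<Rightarrow> 'k::field bipoly set \<Rightarrow> 'k bipoly ^ 3 \<Rightarrow> bool" where
  "bpf_subspace n W f \<longleftrightarrow>
     poly_space.subspace W \<and> W \<subseteq> graded_part (1, int n) \<and> poly_space.dim W = 3 \<and>
     W = poly_space.span (range (($) f)) \<and> basepoint_free f"

end

theory Submission
  imports Defs "HOL-Computational_Algebra.Polynomial"
begin

text \<open>Write $f_i = s\,p_i + t\,q_i$ and dehomogenise by $u = x$, $v = 1$, so that $p$ and $q$ are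
vectors in $K[x]^3$ of degree at most $n$, and let $f_j \in K^6$ collect the coefficients of $x^j$
in $q$ and $p$. The number of minimal syzygies of bidegree $(3, *)$ turns out to be $\dim \langle
f_0, \dots, f_n \rangle - 1$ (\<open>betti1_3_eq\<close>), and both halves of the theorem are read off from
this.

Base point freeness makes the $2 \times 2$ minors $p \times q$ generate the unit ideal of $K[x]$
and not vanish at infinity (\<open>unimodular_minors\<close>). From a vector $y$ with $y \cdot (p \times q) =
1$ one gets explicit formulas showing that over $K[x]$ every syzygy which is linear or quadratic
in $s, t$ is a Koszul syzygy $a \times f$ (\<open>koszul_linear\<close>, \<open>koszul_quadratic\<close>). What is left is
bookkeeping with degrees in $x$. A linear syzygy of $x$-degree less than $n$ vanishes, because the
leading coefficient of $a \times f$ cannot cancel (\<open>linear_syzygy_eq_0\<close>). A quadratic syzygy of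
$x$-degree $e \<ge> n$ has the same leading coefficient as a Koszul syzygy of $x$-degree $e$, so it is
not minimal. Hence all minimal syzygies in question have $x$-degree $e < n$, and there minimality
is measured modulo $u$ and $v$ only: the number of them is the growth, from degree $e - 1$ to
degree $e$, of the space of leading coefficients.

These leading coefficients have the form $a \times f_n$ with $a \in K^6$ determined up to
multiples of $f_n$. The space of all $a$ obtained from degree below $m$ is called \<open>lead_space m\<close>;
so the sum telescopes to $\dim$ \<open>lead_space n\<close> $-\,1$. Reducing $x^n a$ modulo $f$, and conversely
cutting $f$ off at $x^j$, shows that \<open>lead_space n\<close> is spanned by $f_0, \dots, f_n$
(\<open>lead_space_eq\<close>).

The span lies in $K^6$, so the count is at most $5$. If it were $0$, then all $f_j$ would be
multiples of $f_n$, so $p$ and $q$ would have a common factor of degree $n > 0$, and so would the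
minors. For the value $k$ it suffices to find, with $n = k$, a base point free net with
independent $f_0, \dots, f_n$ (\<open>ex_betti1_3\<close>).\<close>

section \<open>Cross products over a commutative ring\<close>

definition dot :: "'a::comm_ring_1 ^ 3 \<Rightarrow> 'a ^ 3 \<Rightarrow> 'a" where
  "dot a b = (\<Sum>i\<in>UNIV. a $ i * b $ i)"

definition cross :: "'a::comm_ring_1 ^ 3 \<Rightarrow> 'a ^ 3 \<Rightarrow> 'a ^ 3" where
  "cross a b = vector [a $ 2 * b $ 3 - a $ 3 * b $ 2, a $ 3 * b $ 1 - a $ 1 * b $ 3,
     a $ 1 * b $ 2 - a $ 2 * b $ 1]"

lemma vec3_eq_iff: "a = b \<longleftrightarrow> a $ 1 = b $ 1 \<and> a $ 2 = b $ 2 \<and> a $ 3 = b $ 3" for a b :: "'a ^ 3"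
  by (simp add: vec_eq_iff forall_3)

lemmas cross_expand = vec3_eq_iff dot_def cross_def sum_3 vector_3

lemma cross_zero [simp]: "cross 0 b = 0" "cross a 0 = 0"
  by (simp_all add: cross_expand)

lemma cross_self [simp]: "cross a a = 0"
  by (simp add: cross_expand algebra_simps)

lemma cross_swap: "cross a b = - cross b a"
  by (simp add: cross_expand algebra_simps)

lemma cross_linear:
  "cross (a + b) c = cross a c + cross b c" "cross a (b + c) = cross a b + cross a c"
  "cross (a - b) c = cross a c - cross b c" "cross a (b - c) = cross a b - cross a c"
  "cross (- a) b = - cross a b" "cross a (- b) = - cross a b"
  "cross (x *s a) b = x *s cross a b" "cross a (x *s b) = x *s cross a b"
  by (simp_all add: cross_expand algebra_simps)

lemma dot_linear:
  "dot (a + b) c = dot a c + dot b c" "dot a (b + c) = dot a b + dot a c"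
  "dot (a - b) c = dot a c - dot b c" "dot a (b - c) = dot a b - dot a c"
  "dot (- a) b = - dot a b" "dot a (- b) = - dot a b"
  "dot (x *s a) b = x * dot a b" "dot a (x *s b) = x * dot a b"
  by (simp_all add: cross_expand algebra_simps)

lemma smult_neg: "(- x) *s v = - (x *s v)" "x *s (- v) = - (x *s v)" for v :: "'a::comm_ring_1 ^ 3"
  by (simp_all add: vec3_eq_iff)

lemma dot_zero [simp]: "dot 0 b = 0" "dot a 0 = 0"
  by (simp_all add: cross_expand)

lemma dot_commute: "dot a b = dot b a"
  by (simp add: cross_expand algebra_simps)

lemma dot_cross_same [simp]: "dot (cross a b) a = 0" "dot (cross a b) b = 0"
  by (simp_all add: cross_expand algebra_simps)

lemma dot_cross_rotate: "dot (cross a b) c = dot a (cross b c)"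
  by (simp add: cross_expand algebra_simps)

lemma cross_cross: "cross (cross a b) c = dot a c *s b - dot b c *s a"
  by (simp add: cross_expand algebra_simps)

text \<open>Expansion in the basis dual to \<open>y\<close>, \<open>p\<close>, \<open>q\<close>, cleared of the denominator.\<close>

lemma cramer:
  "dot y (cross p q) *s g = dot g q *s cross y p + dot g y *s cross p q + dot g p *s cross q y"
  by (simp add: cross_expand algebra_simps)

text \<open>The syzygies of \<open>s p + t q\<close> are solved over any ring in which the minors \<open>p \<times> q\<close> are
unimodular. With \<open>t = 1\<close> and \<open>z = y \<times> p\<close> one has \<open>z \<cdot> f = 1\<close>, so that a syzygy \<open>g\<close> equals \<open>(z \<times> g)
\<times> f\<close>; the multiple of \<open>f\<close> subtracted below lowers the degree of \<open>z \<times> g\<close> in \<open>s\<close> by one, which makes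
the relation homogeneous in \<open>s\<close> and \<open>t\<close>. Here \<open>g = s b + t c\<close>.\<close>

lemma koszul_linear:
  assumes y: "dot y (cross p q) = 1"
    and g: "dot c q = 0" "dot c p + dot b q = 0" "dot b p = 0"
  defines "a \<equiv> cross (cross y p) c - dot y b *s q"
  shows "cross a q = c" "cross a p = b"
proof -
  have "dot (cross y p) q = 1" using y by (simp add: dot_cross_rotate)
  then show "cross a q = c"
    using g by (simp add: a_def cross_linear cross_cross[of "cross y p" c q])
  have "b = dot b q *s cross y p + dot b y *s cross p q + dot b p *s cross q y"
    using cramer[of y p q b] y by simp
  moreover have "dot c p = - dot b q"
    using g(2) by (simp add: eq_neg_iff_add_eq_0)
  ultimately show "cross a p = b"
    using g by (simp add: a_def cross_linear cross_cross[of
        "cross y p" c p] smult_neg cross_swap[of q p]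
        dot_commute[of y b])
qed

text \<open>The same for \<open>g = t\<^sup>2 g0 + s t g1 + s\<^sup>2 g2\<close>, where the multiplier is \<open>t a0 + s a1\<close>.\<close>

lemma koszul_quadratic:
  assumes y: "dot y (cross p q) = 1"
    and g: "dot g0 q = 0" "dot g0 p + dot g1 q = 0" "dot g1 p + dot g2 q = 0" "dot g2 p = 0"
  defines "a0 \<equiv> cross (cross y p) g0" and "a1 \<equiv> cross (cross y p) g1 - dot y g2 *s q"
  shows "cross a0 q = g0" "cross a0 p + cross a1 q = g1" "cross a1 p = g2"
proof -
  have z: "dot (cross y p) q = 1" using y by (simp add: dot_cross_rotate)
  then show "cross a0 q = g0"
    using g by (simp add: a0_def cross_linear cross_cross[of "cross y p" g0 q])
  have "dot g0 p = - dot g1 q"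
    using g(2) by (simp add: eq_neg_iff_add_eq_0)
  then show "cross a0 p + cross a1 q = g1"
    using z g by (simp add: a0_def a1_def cross_linear cross_cross[of "cross y p" _ p]
        cross_cross[of "cross y p" _ q] smult_neg)
  have "g2 = dot g2 q *s cross y p + dot g2 y *s cross p q + dot g2 p *s cross q y"
    using cramer[of y p q g2] y by simp
  moreover have "dot g1 p = - dot g2 q"
    using g(3) by (simp add: eq_neg_iff_add_eq_0)
  ultimately show "cross a1 p = g2"
    using g by (simp add: a1_def cross_linear cross_cross[of
        "cross y p" g1 p] smult_neg cross_swap[of q p]
        dot_commute[of y g2])
qed

lemma koszul_kernel_linear:
  assumes y: "dot y (cross p q) = 1" and "cross a q = 0" "cross a p = 0"
  shows "a = 0"
proof -
  have "dot (cross y p) q = 1" using y by (simp add: dot_cross_rotate)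
  then have "a = dot (cross y p) a *s q"
    using cross_cross[of a q "cross y p"] assms by (simp add: dot_commute)
  then have "0 = cross (dot (cross y p) a *s q) p" using assms by simp
  then have "0 = dot y (cross (dot (cross y p) a *s q) p)" by simp
  then have "dot (cross y p) a = 0"
    using y by (simp add: cross_linear dot_linear cross_swap[of q p])
  then show ?thesis using \<open>a = dot (cross y p) a *s q\<close> by simp
qed

text \<open>The multiplier \<open>t a0 + s a1\<close> is determined up to a multiple of \<open>f\<close>, because \<open>f\<close> has no base
points.\<close>

lemma koszul_kernel_quadratic:
  assumes y: "dot y (cross p q) = 1"
    and k: "cross a0 q = 0" "cross a0 p + cross a1 q = 0" "cross a1 p = 0"
  obtains \<mu> where "a0 = \<mu> *s q" "a1 = \<mu> *s p"
proof -
  have z: "dot (cross y p) q = 1" "dot (cross q y) p = 1"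
    using y by (simp_all add: cross_expand algebra_simps)
  have a: "a0 = dot (cross y p) a0 *s q" "a1 = dot (cross q y) a1 *s p"
    using cross_cross[of a0 q "cross y p"] cross_cross[of a1 p "cross q y"] k z
    by (simp_all add: dot_commute)
  define \<mu> \<nu> where "\<mu> = dot (cross y p) a0" and "\<nu> = dot (cross q y) a1"
  have "0 = dot y (cross (\<mu> *s q) p + cross (\<nu> *s p) q)"
    using k(2) a by (simp add: \<mu>_def \<nu>_def)
  also have "\<dots> = \<nu> - \<mu>"
    using y by (simp add: cross_linear dot_linear cross_swap[of q p])
  finally show ?thesis using a that by (simp add: \<mu>_def \<nu>_def)
qed

section \<open>Vectors of polynomials\<close>

definition vec_coeff :: "nat \<Rightarrow> 'a::comm_ring_1 poly ^ 3 \<Rightarrow> 'a ^ 3" where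
  "vec_coeff k v = (\<chi> i. coeff (v $ i) k)"

text \<open>The degree is bounded strictly, so that the bound \<open>0\<close> expresses that the vector vanishes.\<close>

definition vec_below :: "nat \<Rightarrow> 'a::comm_ring_1 poly ^ 3 \<Rightarrow> bool" where
  "vec_below m v \<longleftrightarrow> (\<forall>k\<ge>m. vec_coeff k v = 0)"

lemma vec_coeff_nth [simp]: "vec_coeff k v $ i = coeff (v $ i) k"
  by (simp add: vec_coeff_def)

lemma vec_coeff_linear [simp]:
  "vec_coeff k 0 = 0" "vec_coeff k (a + b) = vec_coeff k a + vec_coeff k b"
  "vec_coeff k (a - b) = vec_coeff k a - vec_coeff k b" "vec_coeff k (- a) = - vec_coeff k a"
  "vec_coeff k ([:c:] *s a) = c *s vec_coeff k a"
  by (simp_all add: vec_eq_iff)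

lemma vec_coeff_monom:
  "vec_coeff k (monom c m *s a) = (if k < m then 0 else c *s vec_coeff (k - m) a)"
  by (simp add: vec_eq_iff coeff_monom_mult)

lemma vec_poly_eqI: "(\<And>k. vec_coeff k a = vec_coeff k b) \<Longrightarrow> a = b"
  by (simp add: vec_eq_iff poly_eq_iff)

lemma vec_below_0 [simp]: "vec_below 0 v \<longleftrightarrow> v = 0"
  by (auto simp: vec_below_def intro: vec_poly_eqI)

lemma vec_below_mono: "vec_below m v \<Longrightarrow> m \<le> k \<Longrightarrow> vec_below k v"
  by (auto simp: vec_below_def)

lemma vec_below_linear:
  "vec_below m 0" "vec_below m a \<Longrightarrow> vec_below m b \<Longrightarrow> vec_below m (a + b)"
  "vec_below m a \<Longrightarrow> vec_below m b \<Longrightarrow> vec_below m (a - b)" "vec_below m a \<Longrightarrow> vec_below m (- a)"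
  "vec_below m a \<Longrightarrow> vec_below m ([:c:] *s a)"
  by (simp_all add: vec_below_def)

lemma vec_below_exists: "\<exists>m. vec_below m v"
proof (intro exI)
  let ?d = "Max (range (\<lambda>i. degree (v $ i)))"
  have "degree (v $ i) < k" if "Suc ?d \<le> k" for i k
    using that by (intro le_less_trans[OF Max_ge Suc_le_lessD[OF that]]) simp_all
  then show "vec_below (Suc ?d) v"
    unfolding vec_below_def vec_eq_iff by (simp add: coeff_eq_0)
qed

lemma vec_below_drop:
  assumes "vec_below (Suc m) v" "vec_coeff m v = 0"
  shows "vec_below m v"
  unfolding vec_below_def
proof (intro allI impI)
  fix k assume "k \<ge> m"
  then show "vec_coeff k v = 0"
    using assms unfolding vec_below_def by (cases "k = m") auto
qed

lemma vec_coeff_cross: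
    "vec_coeff k (cross a b) = (\<Sum>i\<le>k. cross (vec_coeff i a) (vec_coeff (k - i) b))"
  by (simp add: vec3_eq_iff cross_def coeff_mult sum_subtractf)

lemma vec_below_cross:
  assumes "vec_below m a" "vec_below (Suc n) b"
  shows "vec_below (m + n) (cross a b)"
  unfolding vec_below_def vec_coeff_cross
proof (intro allI impI sum.neutral ballI)
  fix k i assume "k \<ge> m + n" "i \<in> {..k}"
  then have "i \<ge> m \<or> k - i \<ge> Suc n" by auto
  then show "cross (vec_coeff i a) (vec_coeff (k - i) b) = 0"
    using assms by (auto simp: vec_below_def)
qed

lemma coeff_mult_top:
  fixes a b :: "'a::comm_semiring_0 poly"
  assumes "\<And>k. k > m \<Longrightarrow> coeff a k = 0" "\<And>k. k > n \<Longrightarrow> coeff b k = 0"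
  shows "coeff (a * b) (m + n) = coeff a m * coeff b n"
proof -
  have "coeff (a * b) (m + n) = (\<Sum>i\<in>{m}. coeff a i * coeff b (m + n - i))"
    unfolding coeff_mult
  proof (rule sum.mono_neutral_right)
    show "\<forall>i\<in>{..m + n} - {m}. coeff a i * coeff b (m + n - i) = 0"
    proof
      fix i assume "i \<in> {..m + n} - {m}"
      then have "i > m \<or> m + n - i > n" by auto
      then show "coeff a i * coeff b (m + n - i) = 0" using assms by auto
    qed
  qed auto
  then show ?thesis by simp
qed

lemma vec_belowD: "vec_below m v \<Longrightarrow> k \<ge> m \<Longrightarrow> coeff (v $ i) k = 0"
  by (simp add: vec_below_def vec_eq_iff)

lemma coeff_dot_top:
  assumes "vec_below (Suc m) a" "vec_below (Suc n) b"
  shows "coeff (dot a b) (m + n) = dot (vec_coeff m a) (vec_coeff n b)"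
  unfolding dot_def coeff_sum vec_coeff_nth
  by (intro sum.cong refl coeff_mult_top) (use vec_belowD[OF assms(1)] vec_belowD[OF assms(2)] in
      simp_all)

lemma vec_coeff_cross_top:
  assumes "vec_below (Suc m) a" "vec_below (Suc n) b"
  shows "vec_coeff (m + n) (cross a b) = cross (vec_coeff m a) (vec_coeff n b)"
  using vec_belowD[OF assms(1)] vec_belowD[OF assms(2)]
  by (simp add: vec3_eq_iff cross_def coeff_mult_top[of m _ n])

section \<open>Leading coefficients of quadratic syzygies\<close>

text \<open>The coefficient of a monomial in \<open>u\<close> and \<open>v\<close> of a vector \<open>t a + s b\<close> is a point of a
six-dimensional space; a single finite index type is used for it, so that its dimension theory is
at hand.\<close>

definition pair_vec :: "'a ^ 3 \<Rightarrow> 'a ^ 3 \<Rightarrow> 'a ^ (3 + 3)" where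
  "pair_vec a b = (\<chi> k. case k of Inl i \<Rightarrow> a $ i | Inr i \<Rightarrow> b $ i)"

lemma pair_vec_nth [simp]: "pair_vec a b $ Inl i = a $ i" "pair_vec a b $ Inr i = b $ i"
  by (simp_all add: pair_vec_def)

lemma vec6_eq_iff: "v = w \<longleftrightarrow> (\<forall>i. v $ Inl i = w $ Inl i) \<and> (\<forall>i. v $ Inr i = w $ Inr i)"
  for v w :: "'a ^ (3 + 3)"
  by (auto simp: vec_eq_iff split_sum_all)

lemma pair_vec_eq_iff [simp]: "pair_vec a b = pair_vec c d \<longleftrightarrow> a = c \<and> b = d"
  by (simp add: vec6_eq_iff) (simp add: vec_eq_iff)

lemma pair_vec_linear:
  "pair_vec a b + pair_vec c d = pair_vec (a + c) (b + d)"
  "pair_vec a b - pair_vec c d = pair_vec (a - c) (b - d)"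
  "x *s pair_vec a b = pair_vec (x *s a) (x *s b)"
  by (simp_all add: vec6_eq_iff)

lemma pair_vec_zero: "pair_vec 0 0 = 0"
  by (simp add: vec6_eq_iff)

lemma pair_vec_cases: obtains a b where "v = pair_vec a b"
proof
  show "v = pair_vec (\<chi> i. v $ Inl i) (\<chi> i. v $ Inr i)" by (simp add: vec6_eq_iff)
qed

text \<open>The coefficients in \<open>s\<close> and \<open>t\<close> of the equation \<open>(t\<^sup>2 g0 + s t g1 + s\<^sup>2 g2) \<cdot> (s p + t q) =
0\<close>.\<close>

definition quadratic_syzygy ::
    "'a::comm_ring_1 ^ 3 \<Rightarrow> 'a ^ 3 \<Rightarrow> 'a ^ 3 \<Rightarrow> 'a ^ 3 \<Rightarrow> 'a ^ 3 \<Rightarrow> bool" where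
  "quadratic_syzygy p q g0 g1 g2 \<longleftrightarrow>
     dot g0 q = 0 \<and> dot g0 p + dot g1 q = 0 \<and> dot g1 p + dot g2 q = 0 \<and> dot g2 p = 0"

lemma quadratic_syzygy_cross:
    "quadratic_syzygy p q (cross a0 q) (cross a0 p + cross a1 q) (cross a1 p)"
proof -
  have "dot (cross a0 q) p + dot (cross a0 p) q = 0" "dot (cross a1 q) p + dot (cross a1 p) q = 0"
    by (simp_all add: cross_expand algebra_simps)
  then show ?thesis by (simp add: quadratic_syzygy_def dot_linear add.commute)
qed

text \<open>The situation after dehomogenising. The two unimodularity conditions say that \<open>s p + t q\<close>
has no base points over the affine line and over the point at infinity, respectively.\<close>

locale pencil =
  fixes n :: nat and p q y :: "'k::field poly ^ 3" and y' :: "'k ^ 3"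
  assumes n: "n > 0" and below: "vec_below (Suc n) p" "vec_below (Suc n) q"
    and y: "dot y (cross p q) = 1"
    and y': "dot y' (cross (vec_coeff n p) (vec_coeff n q)) = 1"
begin

abbreviation "p\<^sub>n \<equiv> vec_coeff n p"
abbreviation "q\<^sub>n \<equiv> vec_coeff n q"

definition f_coeff :: "nat \<Rightarrow> 'k ^ (3 + 3)" where
  "f_coeff j = pair_vec (vec_coeff j q) (vec_coeff j p)"

text \<open>The leading coefficient of a quadratic syzygy is \<open>a \<times> f\<^sub>n\<close> for some \<open>a = t a0 + s a1\<close>, and
this definition records \<open>a\<close> rather than the coefficient: the ambient space has dimension \<open>6\<close>, and
the ambiguity is exactly the line spanned by \<open>f\<^sub>n\<close>. The degree of the syzygies is below \<open>m\<close>, and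
the coefficient taken is that of \<open>x ^ (m - 1)\<close>; the factor \<open>x\<close> avoids a subtraction and makes \<open>m =
0\<close> meaningful.\<close>

definition lead_space :: "nat \<Rightarrow> ('k ^ (3 + 3)) set" where
  "lead_space m = {pair_vec a0 a1 | a0 a1. \<exists>g0 g1 g2. quadratic_syzygy p q g0 g1 g2 \<and>
     vec_below m g0 \<and> vec_below m g1 \<and> vec_below m g2 \<and>
     vec_coeff m (monom 1 1 *s g0) = cross a0 q\<^sub>n \<and>
     vec_coeff m (monom 1 1 *s g1) = cross a0 p\<^sub>n + cross a1 q\<^sub>n \<and>
     vec_coeff m (monom 1 1 *s g2) = cross a1 p\<^sub>n}"

text \<open>By the Koszul formula the syzygy is \<open>a \<times> f\<close> with \<open>a\<close> free of \<open>s\<close> and \<open>t\<close>. As there is no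
base point at infinity, the leading coefficient of \<open>a\<close> survives multiplication by \<open>f\<^sub>n\<close>, so a
nonzero \<open>a\<close> gives degree at least \<open>n\<close>.\<close>

lemma linear_syzygy_eq_0:
  assumes g: "dot c q = 0" "dot c p + dot b q = 0" "dot b p = 0"
    and bel: "vec_below n b" "vec_below n c"
  shows "b = 0 \<and> c = 0"
proof -
  define a where "a = cross (cross y p) c - dot y b *s q"
  have a: "cross a q = c" "cross a p = b"
    using koszul_linear[OF y g] by (simp_all add: a_def)
  have "vec_below m a \<Longrightarrow> a = 0" for m
  proof (induction m)
    case (Suc m)
    have "cross (vec_coeff m a) p\<^sub>n = vec_coeff (m + n) b"
      "cross (vec_coeff m a) q\<^sub>n = vec_coeff (m + n) c"
      using vec_coeff_cross_top[OF Suc.prems below(1)] vec_coeff_cross_top[OF Suc.prems below(2)]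
      unfolding a by simp_all
    then have "vec_coeff m a = 0"
      using bel koszul_kernel_linear[OF y'] by (simp add: vec_below_def)
    then show ?case
      using Suc.IH vec_below_drop[OF Suc.prems] by simp
  qed simp
  then have "a = 0" using vec_below_exists[of a] by auto
  then show ?thesis using a by simp
qed

text \<open>Euclidean division of a multiplier by \<open>f\<close>: as long as its degree is at least \<open>n\<close>, the
vanishing of the top coefficient of \<open>c \<times> f\<close> forces its own top coefficient to be a multiple of
\<open>f\<^sub>n\<close>, which can be removed without changing \<open>c \<times> f\<close>.\<close>

lemma reduce_modulo_f:
  assumes "vec_below m c0" "vec_below m c1"
    "vec_below (2 * n) (cross c0 q)" "vec_below (2 * n) (cross c0 p + cross c1 q)"
    "vec_below (2 * n) (cross c1 p)"
  shows "\<exists>h. vec_below n (c0 - h *s q) \<and> vec_below n (c1 - h *s p)"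
  using assms
proof (induction m arbitrary: c0 c1)
  case 0
  then show ?case by (intro exI[of _ 0]) (simp add: vec_below_linear)
next
  case (Suc m)
  show ?case
  proof (cases "Suc m \<le> n")
    case True
    then show ?thesis
      using Suc.prems by (intro exI[of _ 0]) (simp add: vec_below_mono[OF _ True])
  next
    case False
    then have m: "2 * n \<le> m + n" "n \<le> m" by auto
    note top = vec_coeff_cross_top[OF Suc.prems(1) below(1)]
      vec_coeff_cross_top[OF Suc.prems(1) below(2)] vec_coeff_cross_top[OF Suc.prems(2) below(1)]
      vec_coeff_cross_top[OF Suc.prems(2) below(2)]
    obtain \<mu> where \<mu>: "vec_coeff m c0 = \<mu> *s q\<^sub>n" "vec_coeff m c1 = \<mu> *s p\<^sub>n"
    proof (rule koszul_kernel_quadratic[OF y'])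
      show "cross (vec_coeff m c0) q\<^sub>n = 0"
          "cross (vec_coeff m c0) p\<^sub>n + cross (vec_coeff m c1) q\<^sub>n = 0"
        "cross (vec_coeff m c1) p\<^sub>n = 0"
        using Suc.prems(3-5) m
        by (simp_all add: vec_below_def top(1)[symmetric] top(2)[symmetric] top(3)[symmetric]
          top(4)[symmetric] flip: vec_coeff_linear(2))
    qed
    define t where "t = monom \<mu> (m - n)"
    have t: "vec_below m (c - t *s r)" if "vec_below (Suc m) c" "vec_below (Suc n) r"
      "vec_coeff m c = \<mu> *s vec_coeff n r" for c r
    proof (rule vec_below_drop)
      show "vec_below (Suc m) (c - t *s r)"
        using that m by (auto simp: vec_below_def t_def vec_coeff_monom)
      show "vec_coeff m (c - t *s r) = 0"
        using that m by (simp add: t_def vec_coeff_monom)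
    qed
    have "cross (c0 - t *s q) q = cross c0 q" "cross (c1 - t *s p) p = cross c1 p"
      "cross (c0 - t *s q) p + cross (c1 - t *s p) q = cross c0 p + cross c1 q"
      by (simp_all add: cross_linear cross_swap[of q p] smult_neg)
    then have "\<exists>h. vec_below n (c0 - t *s q - h *s q) \<and> vec_below n (c1 - t *s p - h *s p)"
      using Suc.prems \<mu> by (intro Suc.IH t below) simp_all
    then obtain h where "vec_below n (c0 - t *s q - h *s q)" "vec_below n (c1 - t *s p - h *s p)"
      by blast
    then show ?thesis
      by (intro exI[of _ "t + h"]) (simp add: vector_sadd_rdistrib algebra_simps)
  qed
qed

lemma pair_vec_in_lead_space_iff: "pair_vec a0 a1 \<in> lead_space m \<longleftrightarrow>
    (\<exists>g0 g1 g2. quadratic_syzygy p q g0 g1 g2 \<and>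
     vec_below m g0 \<and> vec_below m g1 \<and> vec_below m g2 \<and>
     vec_coeff m (monom 1 1 *s g0) = cross a0 q\<^sub>n \<and>
     vec_coeff m (monom 1 1 *s g1) = cross a0 p\<^sub>n + cross a1 q\<^sub>n \<and>
     vec_coeff m (monom 1 1 *s g2) = cross a1 p\<^sub>n)"
  unfolding lead_space_def by (auto 4 3)

lemma lead_spaceI:
  assumes "quadratic_syzygy p q g0 g1 g2" "vec_below m g0" "vec_below m g1" "vec_below m g2"
    "vec_coeff m (monom 1 1 *s g0) = cross a0 q\<^sub>n"
    "vec_coeff m (monom 1 1 *s g1) = cross a0 p\<^sub>n + cross a1 q\<^sub>n"
    "vec_coeff m (monom 1 1 *s g2) = cross a1 p\<^sub>n"
  shows "pair_vec a0 a1 \<in> lead_space m"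
  unfolding pair_vec_in_lead_space_iff using assms by blast

lemma lead_spaceE:
  assumes "pair_vec a0 a1 \<in> lead_space m"
  obtains g0 g1 g2 where "quadratic_syzygy p q g0 g1 g2" "vec_below m g0" "vec_below m g1"
      "vec_below m g2"
    "vec_coeff m (monom 1 1 *s g0) = cross a0 q\<^sub>n"
    "vec_coeff m (monom 1 1 *s g1) = cross a0 p\<^sub>n + cross a1 q\<^sub>n"
    "vec_coeff m (monom 1 1 *s g2) = cross a1 p\<^sub>n"
  using assms unfolding pair_vec_in_lead_space_iff by blast

lemma quadratic_syzygy_linear:
  "quadratic_syzygy r s 0 0 0"
  "quadratic_syzygy r s g0 g1 g2 \<Longrightarrow> quadratic_syzygy r s h0 h1 h2
      \<Longrightarrow> quadratic_syzygy r s (g0 + h0) (g1 + h1) (g2 + h2)"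
  "quadratic_syzygy r s g0 g1 g2 \<Longrightarrow> quadratic_syzygy r s h0 h1 h2
      \<Longrightarrow> quadratic_syzygy r s (g0 - h0) (g1 - h1) (g2 - h2)"
  "quadratic_syzygy r s g0 g1 g2 \<Longrightarrow> quadratic_syzygy r s (x *s g0) (x *s g1) (x *s g2)"
  by (simp_all add: quadratic_syzygy_def dot_linear add_eq_0_iff2)

lemma subspace_lead_space: "vec.subspace (lead_space m)"
proof (rule vec.subspaceI)
  show "0 \<in> lead_space m"
    unfolding pair_vec_zero[symmetric]
    by (rule lead_spaceI[of 0 0 0]) (simp_all add: quadratic_syzygy_linear vec_below_linear)
next
  fix a b assume ab: "a \<in> lead_space m" "b \<in> lead_space m"
  obtain a0 a1 b0 b1 where eq: "a = pair_vec a0 a1" "b = pair_vec b0 b1"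
    by (metis pair_vec_cases)
  obtain g0 g1 g2 where g: "quadratic_syzygy p q g0 g1 g2" "vec_below m g0" "vec_below m g1"
      "vec_below m g2"
    "vec_coeff m (monom 1 1 *s g0) = cross a0 q\<^sub>n"
    "vec_coeff m (monom 1 1 *s g1) = cross a0 p\<^sub>n + cross a1 q\<^sub>n"
    "vec_coeff m (monom 1 1 *s g2) = cross a1 p\<^sub>n"
    using ab(1) unfolding eq by (rule lead_spaceE)
  obtain h0 h1 h2 where h: "quadratic_syzygy p q h0 h1 h2" "vec_below m h0" "vec_below m h1"
      "vec_below m h2"
    "vec_coeff m (monom 1 1 *s h0) = cross b0 q\<^sub>n"
    "vec_coeff m (monom 1 1 *s h1) = cross b0 p\<^sub>n + cross b1 q\<^sub>n"
    "vec_coeff m (monom 1 1 *s h2) = cross b1 p\<^sub>n"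
    using ab(2) unfolding eq by (rule lead_spaceE)
  show "a + b \<in> lead_space m"
    unfolding eq pair_vec_linear
    by (rule lead_spaceI[of "g0 + h0" "g1 + h1" "g2 + h2"])
      (use g h in \<open>simp_all add: quadratic_syzygy_linear vec_below_linear vector_add_ldistrib
          cross_linear\<close>)
next
  fix c :: 'k and a assume a: "a \<in> lead_space m"
  obtain a0 a1 where eq: "a = pair_vec a0 a1" by (rule pair_vec_cases)
  obtain g0 g1 g2 where g: "quadratic_syzygy p q g0 g1 g2" "vec_below m g0" "vec_below m g1"
      "vec_below m g2"
    "vec_coeff m (monom 1 1 *s g0) = cross a0 q\<^sub>n"
    "vec_coeff m (monom 1 1 *s g1) = cross a0 p\<^sub>n + cross a1 q\<^sub>n"
    "vec_coeff m (monom 1 1 *s g2) = cross a1 p\<^sub>n"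
    using a unfolding eq by (rule lead_spaceE)
  have "vec_coeff m (monom 1 1 *s ([:c:] *s g)) = c *s vec_coeff m (monom 1 1 *s g)"
    for g :: "'k poly ^ 3"
    by (simp add: vec_coeff_monom)
  then show "c *s a \<in> lead_space m"
    unfolding eq pair_vec_linear
    by (intro lead_spaceI[of "[:c:] *s g0" "[:c:] *s g1" "[:c:] *s g2"])
      (use g in \<open>simp_all add: quadratic_syzygy_linear vec_below_linear vector_add_ldistrib
          cross_linear\<close>)
qed

lemma lead_space_Suc: "lead_space m \<subseteq> lead_space (Suc m)"
proof
  fix a assume a: "a \<in> lead_space m"
  obtain a0 a1 where eq: "a = pair_vec a0 a1" by (rule pair_vec_cases)
  obtain g0 g1 g2 where g: "quadratic_syzygy p q g0 g1 g2" "vec_below m g0" "vec_below m g1"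
      "vec_below m g2"
    "vec_coeff m (monom 1 1 *s g0) = cross a0 q\<^sub>n"
    "vec_coeff m (monom 1 1 *s g1) = cross a0 p\<^sub>n + cross a1 q\<^sub>n"
    "vec_coeff m (monom 1 1 *s g2) = cross a1 p\<^sub>n"
    using a unfolding eq by (rule lead_spaceE)
  have "vec_coeff (Suc m) (monom 1 1 *s (monom 1 1 *s g)) = vec_coeff m (monom 1 1 *s g)"
    for g :: "'k poly ^ 3"
    by (simp add: vec_coeff_monom)
  moreover have "vec_below (Suc m) (monom 1 1 *s g)" if "vec_below m g" for g :: "'k poly ^ 3"
    using that by (simp add: vec_below_def vec_coeff_monom)
  ultimately show "a \<in> lead_space (Suc m)"
    unfolding eq
    by (intro lead_spaceI[of "monom 1 1 *s g0" "monom 1 1 *s g1" "monom 1 1 *s g2"])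
      (use g in \<open>simp_all add: quadratic_syzygy_linear\<close>)
qed

lemma lead_space_mono: "m \<le> k \<Longrightarrow> lead_space m \<subseteq> lead_space k"
  using lift_Suc_mono_le[of lead_space] lead_space_Suc by blast

text \<open>Below degree \<open>0\<close> there is only the zero syzygy, and what remains is the ambiguity of the
multiplier.\<close>

lemma lead_space_0: "lead_space 0 = vec.span {f_coeff n}"
proof
  show "lead_space 0 \<subseteq> vec.span {f_coeff n}"
  proof
    fix a assume a: "a \<in> lead_space 0"
    obtain a0 a1 where eq: "a = pair_vec a0 a1" by (rule pair_vec_cases)
    from a have "cross a0 q\<^sub>n = 0" "cross a0 p\<^sub>n + cross a1 q\<^sub>n = 0" "cross a1 p\<^sub>n = 0"
      unfolding eq by (auto elim!: lead_spaceE)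
    then obtain \<mu> where "a0 = \<mu> *s q\<^sub>n" "a1 = \<mu> *s p\<^sub>n"
      by (rule koszul_kernel_quadratic[OF y'])
    then have "a = \<mu> *s f_coeff n" by (simp add: eq f_coeff_def pair_vec_linear)
    then show "a \<in> vec.span {f_coeff n}" by (simp add: vec.span_scale vec.span_base)
  qed
  have "f_coeff n \<in> lead_space 0"
    unfolding f_coeff_def
    by (rule lead_spaceI[of 0 0 0]) (simp_all add: quadratic_syzygy_linear cross_swap[of "q\<^sub>n"
        "p\<^sub>n"])
  then show "vec.span {f_coeff n} \<subseteq> lead_space 0"
    by (intro vec.span_minimal subspace_lead_space) simp
qed

lemma vec_coeff_smult: "vec_coeff k (h *s v) = (\<Sum>i\<le>k. coeff h i *s vec_coeff (k - i) v)"
  by (simp add: vec_eq_iff coeff_mult)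

text \<open>Write \<open>f = x ^ (j + 1) hi + lo\<close> with \<open>lo\<close> of degree at most \<open>j\<close>. From \<open>f \<times> f = 0\<close> it
follows that \<open>x ^ (j + 1) (hi \<times> f) = - lo \<times> f\<close>, so the Koszul syzygy \<open>hi \<times> f\<close> has degree below
\<open>n\<close>, and its leading coefficient is \<open>- f\<^sub>j \<times> f\<^sub>n\<close>.\<close>

lemma f_coeff_in_lead_space:
  assumes "j < n"
  shows "f_coeff j \<in> lead_space n"
proof -
  define hi lo where "hi v = (\<chi> i. poly_shift (Suc j) (v $ i))"
    and "lo v = (\<chi> i. poly_cutoff (Suc j) (v $ i))" for v :: "'k poly ^ 3"
  have coeff_hi: "vec_coeff k (hi v) = vec_coeff (k + Suc j) v" for v k
    by (simp add: vec_eq_iff hi_def coeff_poly_shift add.commute)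
  have coeff_lo: "vec_coeff k (lo v) = (if k < Suc j then vec_coeff k v else 0)" for v k
    by (simp add: vec_eq_iff lo_def coeff_poly_cutoff)
  have split: "monom 1 (Suc j) *s hi v = v - lo v" for v
    by (rule vec_poly_eqI) (simp add: vec_coeff_monom coeff_hi coeff_lo)
  have lo: "vec_below (Suc j) (lo v)" for v
    by (simp add: vec_below_def coeff_lo)
  have coeffs: "vec_coeff k (cross (hi v) w) = vec_coeff (k + Suc j) (cross v w) - vec_coeff (k +
      Suc j) (cross (lo v) w)"
    for k v w
  proof -
    have "vec_coeff k (cross (hi v) w) = vec_coeff (k + Suc j) (monom 1 (Suc j) *s cross (hi v) w)"
      by (simp add: vec_coeff_monom)
    also have "\<dots> = vec_coeff (k + Suc j) (cross v w - cross (lo v) w)"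
      by (simp only: split flip: cross_linear)
    finally show ?thesis by simp
  qed
  have cross0: "vec_coeff k (cross v w) + vec_coeff k (cross w v) = 0" for k and v w ::
      "'k poly ^ 3"
    by (simp add: cross_swap[of v w])
  let ?g0 = "- cross (hi q) q" and ?g1 = "- (cross (hi q) p + cross (hi p) q)"
      and ?g2 = "- cross (hi p) p"
  have coeff_g: "vec_coeff k ?g0 = vec_coeff (k + Suc j) (cross (lo q) q)"
    "vec_coeff k ?g1 = vec_coeff (k + Suc j) (cross (lo q) p) + vec_coeff (k +
        Suc j) (cross (lo p) q)"
    "vec_coeff k ?g2 = vec_coeff (k + Suc j) (cross (lo p) p)" for k
    using cross0[of "k + Suc j" p q] by (simp_all add: coeffs algebra_simps eq_neg_iff_add_eq_0)
  have bel: "vec_coeff (k + Suc j) (cross (lo v) w) = 0" if "k \<ge> n" "vec_below (Suc n) w" for k v w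
    using vec_below_cross[OF lo that(2)] that(1) by (simp add: vec_below_def)
  have top: "vec_coeff (n - 1 + Suc j) (cross (lo v) w) = cross (vec_coeff j v) (vec_coeff n w)"
    if "vec_below (Suc n) w" for v w
    using vec_coeff_cross_top[OF lo that, of v] n by (simp add: coeff_lo add.commute)
  have shift: "vec_coeff n (monom 1 1 *s g) = vec_coeff (n - 1) g" for g :: "'k poly ^ 3"
    using n by (simp add: vec_coeff_monom)
  show ?thesis
    unfolding f_coeff_def
  proof (rule lead_spaceI)
    have neg: "[:-1:] *s v = - v" for v :: "'k poly ^ 3"
      by (simp add: vec_eq_iff)
    have "quadratic_syzygy p q ([:-1:] *s cross (hi q) q) ([:-1:] *s (cross (hi q) p +
        cross (hi p) q))
        ([:-1:] *s cross (hi p) p)"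
      by (intro quadratic_syzygy_linear(4) quadratic_syzygy_cross)
    then show "quadratic_syzygy p q ?g0 ?g1 ?g2"
      unfolding neg .
    show "vec_below n ?g0" "vec_below n ?g1" "vec_below n ?g2"
      unfolding vec_below_def coeff_g using bel below by simp_all
  qed (simp_all only: shift coeff_g top below)
qed

text \<open>Conversely, let \<open>g = b \<times> f\<close> have degree below \<open>n\<close>. Dividing \<open>x\<^sup>n b\<close> by \<open>f\<close> leaves a
remainder \<open>d = x\<^sup>n b - h f\<close> of degree below \<open>n\<close> with \<open>d \<times> f = x\<^sup>n g\<close>, so the leading coefficient
of \<open>g\<close> is that of \<open>d\<close> times \<open>f\<^sub>n\<close>. But \<open>x\<^sup>n b\<close> does not contribute to the coefficients of \<open>d\<close>,
which therefore are combinations of those of \<open>f\<close>.\<close>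

theorem lead_space_eq: "lead_space n = vec.span (f_coeff ` {..n})"
proof
  have "f_coeff j \<in> lead_space n" if "j \<le> n" for j
    using that f_coeff_in_lead_space[of j] lead_space_0 lead_space_mono[of 0 n] vec.span_base[of
        "f_coeff n" "{f_coeff n}"]
    by (cases "j = n") auto
  then show "vec.span (f_coeff ` {..n}) \<subseteq> lead_space n"
    by (intro vec.span_minimal subspace_lead_space) auto
  show "lead_space n \<subseteq> vec.span (f_coeff ` {..n})"
  proof
    fix a assume a: "a \<in> lead_space n"
    obtain a0 a1 where eq: "a = pair_vec a0 a1" by (rule pair_vec_cases)
    obtain g0 g1 g2 where syz: "quadratic_syzygy p q g0 g1 g2"
      and bel: "vec_below n g0" "vec_below n g1" "vec_below n g2"
      and lead: "vec_coeff n (monom 1 1 *s g0) = cross a0 q\<^sub>n"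
        "vec_coeff n (monom 1 1 *s g1) = cross a0 p\<^sub>n + cross a1 q\<^sub>n"
        "vec_coeff n (monom 1 1 *s g2) = cross a1 p\<^sub>n"
      using a unfolding eq by (rule lead_spaceE)
    obtain b0 b1 where b: "cross b0 q = g0" "cross b0 p + cross b1 q = g1" "cross b1 p = g2"
      using koszul_quadratic[OF y] syz unfolding quadratic_syzygy_def by metis
    define X :: "'k poly" where "X = monom 1 n"
    define c0 c1 where "c0 = X *s b0" and "c1 = X *s b1"
    have c: "cross c0 q = X *s g0" "cross c0 p + cross c1 q = X *s g1" "cross c1 p = X *s g2"
      by (simp_all add: c0_def c1_def cross_linear flip: b vector_add_ldistrib)
    have below2: "vec_below (2 * n) (X *s g)" if "vec_below n g" for g
      using that by (auto simp: X_def vec_below_def vec_coeff_monom)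
    obtain m0 m1 where "vec_below m0 c0" "vec_below m1 c1" using vec_below_exists by blast
    then have "vec_below (max m0 m1) c0" "vec_below (max m0 m1) c1"
      by (auto elim: vec_below_mono)
    then obtain h where h: "vec_below n (c0 - h *s q)" "vec_below n (c1 - h *s p)"
      using reduce_modulo_f[of "max m0 m1" c0 c1] below2 bel unfolding c by blast
    define d0 d1 where "d0 = c0 - h *s q" and "d1 = c1 - h *s p"
    have d: "cross d0 q = X *s g0" "cross d0 p + cross d1 q = X *s g1" "cross d1 p = X *s g2"
      using c by (simp_all add: d0_def d1_def cross_linear smult_neg cross_swap[of q p])
    obtain k where k: "n = Suc k" using n by (cases n) auto
    \<comment> \<open>Both sides of the equations \<open>d\<close> are compared in degree \<open>2 n - 1 = k + n\<close>.\<close>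
    have top: "vec_coeff (k + n) (cross v w) = cross (vec_coeff k v) (vec_coeff n w)"
      if "vec_below n v" "vec_below (Suc n) w" for v w
      using vec_coeff_cross_top that unfolding k by blast
    have shift: "vec_coeff (k + n) (X *s g) = vec_coeff n (monom 1 1 *s g)" for g :: "'k poly ^ 3"
      by (simp add: X_def vec_coeff_monom k)
    note tops = top[OF h(1) below(1)] top[OF h(1) below(2)] top[OF h(2) below(1)] top[OF h(2)
        below(2)]
    have "cross (a0 - vec_coeff k d0) q\<^sub>n = 0" "cross (a1 - vec_coeff k d1) p\<^sub>n = 0"
      "cross (a0 - vec_coeff k d0) p\<^sub>n + cross (a1 - vec_coeff k d1) q\<^sub>n = 0"
      using arg_cong[OF d(1), of "vec_coeff (k + n)"] arg_cong[OF d(2), of "vec_coeff (k + n)"]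
        arg_cong[OF d(3), of "vec_coeff (k + n)"] lead
      unfolding shift vec_coeff_linear(2)
      by (simp_all add: tops[folded d0_def d1_def] cross_linear algebra_simps)
    then obtain \<mu> where \<mu>: "a0 - vec_coeff k d0 = \<mu> *s q\<^sub>n" "a1 - vec_coeff k d1 = \<mu> *s p\<^sub>n"
      using koszul_kernel_quadratic[OF y'] by metis
    have "vec_coeff k d0 = - vec_coeff k (h *s q)" "vec_coeff k d1 = - vec_coeff k (h *s p)"
      by (simp_all add: d0_def d1_def c0_def c1_def X_def vec_coeff_monom k)
    with \<mu> have "a0 = \<mu> *s q\<^sub>n - vec_coeff k (h *s q)" "a1 = \<mu> *s p\<^sub>n - vec_coeff k (h *s p)"
      by (simp_all add: algebra_simps)
    moreover have "pair_vec (\<Sum>i\<in>I. u i) (\<Sum>i\<in>I. v i) = (\<Sum>i\<in>I. pair_vec (u i) (v i))"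
      for I and u v :: "nat \<Rightarrow> 'k ^ 3"
      by (simp add: vec6_eq_iff)
    ultimately have "a = \<mu> *s f_coeff n - (\<Sum>i\<le>k. coeff h i *s f_coeff (k - i))"
      by (simp add: eq f_coeff_def pair_vec_linear(3) vec_coeff_smult flip: pair_vec_linear(2))
    also have "\<dots> \<in> vec.span (f_coeff ` {..n})"
      by (intro vec.span_diff vec.span_sum vec.span_scale vec.span_base) (auto simp: k)
    finally show "a \<in> vec.span (f_coeff ` {..n})" .
  qed
qed

lemma f_coeff_n_nonzero: "f_coeff n \<noteq> 0"
proof
  assume "f_coeff n = 0"
  then have "q\<^sub>n = 0" by (simp add: f_coeff_def flip: pair_vec_zero)
  then show False using y' by simp
qed

lemma dim_lead_space_0: "vec.dim (lead_space 0) = 1"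
proof -
  have "vec.independent {f_coeff n}"
    using f_coeff_n_nonzero vec.independent_insertI[of "f_coeff n" "{}"]
        by (simp add: vec.independent_empty)
  then show ?thesis
    using vec.dim_eq_card_independent[of "{f_coeff n}"] by (simp add: lead_space_0)
qed

lemma dim_lead_space_le: "vec.dim (lead_space m) \<le> 6"
  using vec.dim_subset_UNIV[of "lead_space m"] by (simp add: vec.dimension_def card_cart_basis)

text \<open>Otherwise every \<open>f\<^sub>j\<close> is a multiple of \<open>f\<^sub>n\<close>, so \<open>p\<close> and \<open>q\<close> are constant vectors times one
polynomial \<open>h\<close> of degree \<open>n > 0\<close>, and \<open>h\<close> would divide the minors, which generate the unit ideal.\<close>

lemma dim_lead_space_ge: "vec.dim (lead_space n) \<ge> 2"
proof (rule ccontr)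
  assume "\<not> vec.dim (lead_space n) \<ge> 2"
  then have "lead_space 0 = lead_space n"
    using dim_lead_space_0 lead_space_mono[of 0 n]
    by (intro vec.subspace_dim_equal subspace_lead_space) auto
  then have "f_coeff j \<in> vec.span {f_coeff n}" if "j \<le> n" for j
    using that vec.span_base[of "f_coeff j" "f_coeff ` {..n}"] lead_space_0 lead_space_eq by auto
  then have "\<forall>j\<in>{..n}. \<exists>c. f_coeff j = c *s f_coeff n"
    using vec.span_singleton[of "f_coeff n"] by auto
  then obtain c where c: "\<And>j. j \<le> n \<Longrightarrow> f_coeff j = c j *s f_coeff n"
    by (metis atMost_iff)
  have "c n = 1"
    using c[of n] f_coeff_n_nonzero by (metis order_refl vector_smult_lid vec.scale_right_imp_eq)
  define h where "h = (\<Sum>j\<le>n. monom (c j) j)"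
  have coeff_h: "coeff h j = (if j \<le> n then c j else 0)" for j
    by (auto simp: h_def coeff_sum)
  have eq: "r = h *s (\<chi> i. [:vec_coeff n r $ i:])"
    if "vec_below (Suc n) r" "\<And>j. j \<le> n \<Longrightarrow> vec_coeff j r = c j *s vec_coeff n r" for r
  proof (rule vec_poly_eqI)
    fix k
    show "vec_coeff k r = vec_coeff k (h *s (\<chi> i. [:vec_coeff n r $ i:]))"
    proof (cases "k \<le> n")
      case True
      then show ?thesis
        using that(2)[OF True] by (simp add: vec_eq_iff coeff_h mult.commute)
    next
      case False
      then show ?thesis
        using that(1) by (simp add: vec_below_def vec_eq_iff coeff_h)
    qed
  qed
  have "vec_coeff j p = c j *s p\<^sub>n" "vec_coeff j q = c j *s q\<^sub>n" if "j \<le> n" for j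
    using c[OF that] by (simp_all add: f_coeff_def pair_vec_linear)
  then have "p = h *s (\<chi> i. [:p\<^sub>n $ i:])" "q = h *s (\<chi> i. [:q\<^sub>n $ i:])"
    using eq below by blast+
  then have "1 = dot y (cross (h *s (\<chi> i. [:p\<^sub>n $ i:])) (h *s (\<chi> i. [:q\<^sub>n $ i:])))"
    using y by simp
  also have "\<dots> = h * (h * dot y (cross (\<chi> i. [:p\<^sub>n $ i:]) (\<chi> i. [:q\<^sub>n $ i:])))"
    by (simp only: cross_linear dot_linear)
  finally have "h dvd 1" by (metis dvd_triv_left)
  then have "degree h = 0" using dvd_imp_degree_le[of h 1] by simp
  then have "coeff h n = 0" using n by (simp add: coeff_eq_0)
  then show False using \<open>c n = 1\<close> by (simp add: coeff_h)
qed

end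

section \<open>Dimensions of spans and quotients\<close>

text \<open>Stated for families, so that injectivity need not be checked separately.\<close>

lemma (in vector_space) dim_span_family:
  assumes "finite I" and zero: "\<And>u. (\<Sum>i\<in>I. scale (u i) (v i)) = 0 \<Longrightarrow> \<forall>i\<in>I. u i = 0"
  shows "dim (span (v ` I)) = card I"
proof -
  have inj: "inj_on v I"
  proof (rule inj_onI, rule ccontr)
    fix i j assume ij: "i \<in> I" "j \<in> I" "v i = v j" "i \<noteq> j"
    define u where "u k = (if k = i then 1 else if k = j then - 1 else 0 :: 'a)" for k
    have "(\<Sum>k\<in>I. scale (u k) (v k)) = (\<Sum>k\<in>{i, j}. scale (u k) (v k))"
      using ij \<open>finite I\<close> by (intro sum.mono_neutral_right) (auto simp: u_def)
    also have "\<dots> = 0" using ij by (simp add: u_def)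
    finally have "u i = 0" using zero ij by blast
    then show False by (simp add: u_def)
  qed
  have "independent (v ` I)"
  proof (rule independent_if_scalars_zero)
    fix f x assume "(\<Sum>x\<in>v ` I. scale (f x) x) = 0" "x \<in> v ` I"
    then show "f x = 0"
      using zero[of "\<lambda>i. f (v i)"] inj by (auto simp: sum.reindex)
  qed (use \<open>finite I\<close> in simp)
  then show ?thesis
    using inj by (simp add: dim_eq_card_independent card_image)
qed

lemma (in vector_space) quotient_dim_eq_0: "subspace U \<Longrightarrow> V \<subseteq> U \<Longrightarrow> quotient_dim U V = 0"
  by (subst quotient_dim_eq_card[of _ _ "{}"]) (auto simp: quotient_basis_def)

text \<open>A quotient is computed by a linear map whose kernel is only required to be right modulo
\<open>W0\<close>, and whose image need only fill \<open>W1\<close> modulo \<open>W0\<close>. This freedom is needed because the map used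
below picks one of several possible multipliers. A basis is obtained by lifting a basis of \<open>W1\<close>
relative to one of \<open>W0\<close>.\<close>

lemma (in vector_space) quotient_dim_image:
  fixes L :: "'b \<Rightarrow> 'a ^ 'n"
  assumes L: "Vector_Spaces.linear scale ((*s) :: 'a \<Rightarrow> 'a ^ 'n \<Rightarrow> 'a ^ 'n) L" and U: "subspace U"
      and V: "subspace V"
    and W: "vec.subspace W0" "vec.subspace W1" "W0 \<subseteq> W1"
    and into: "\<And>x. x \<in> V \<Longrightarrow> L x \<in> W1"
    and onto: "\<And>w. w \<in> W1 \<Longrightarrow> \<exists>x\<in>V. w - L x \<in> W0"
    and kernel: "\<And>x. x \<in> V \<Longrightarrow> x \<in> U \<longleftrightarrow> L x \<in> W0"
  shows "quotient_dim U V = vec.dim W1 - vec.dim W0"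
proof -
  interpret L: Vector_Spaces.linear scale "(*s) :: 'a \<Rightarrow> 'a ^ 'n \<Rightarrow> 'a ^ 'n" L by (rule L)
  obtain B0 where B0: "B0 \<subseteq> W0" "vec.independent B0" "W0 \<subseteq> vec.span B0"
    by (rule vec.maximal_independent_subset)
  obtain B1 where B1: "B0 \<subseteq> B1" "B1 \<subseteq> W1" "vec.independent B1" "W1 \<subseteq> vec.span B1"
    using vec.maximal_independent_subset_extend[of B0 W1] B0 W by blast
  have fin: "finite B1" using B1(3) vec.independent_bound_general vec.finiteI_independent by blast
  have dims: "vec.dim W0 = card B0" "vec.dim W1 = card B1"
    by (rule vec.dim_unique[OF B0(1,3,2) refl] vec.dim_unique[OF B1(2,4,3) refl])+
  have span0: "vec.span B0 = W0" using B0 W by (simp add: vec.span_minimal subset_antisym)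
  have "\<exists>x\<in>V. b - L x \<in> W0" if "b \<in> B1 - B0" for b using onto that B1 by blast
  then obtain g where g: "\<And>b. b \<in> B1 - B0 \<Longrightarrow> g b \<in> V" "\<And>b. b \<in> B1 - B0 \<Longrightarrow> b - L (g b) \<in> W0"
    by metis
  define D where "D = B1 - B0"
  have finD: "finite D" using fin by (simp add: D_def)
  have key: "\<forall>b\<in>D. c b = 0" if "(\<Sum>b\<in>D. scale (c b) (g b)) \<in> U" for c
  proof -
    have "(\<Sum>b\<in>D. scale (c b) (g b)) \<in> V"
      using V g by (auto simp: D_def intro!: subspace_sum subspace_scale)
    then have "L (\<Sum>b\<in>D. scale (c b) (g b)) \<in> W0" using that kernel by blast
    then have "(\<Sum>b\<in>D. c b *s L (g b)) \<in> W0" by (simp add: L.sum L.scale)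
    moreover have "(\<Sum>b\<in>D. c b *s (b - L (g b))) \<in> W0"
      using W g by (auto simp: D_def intro!: vec.subspace_sum vec.subspace_scale)
    ultimately have "(\<Sum>b\<in>D. c b *s L (g b)) + (\<Sum>b\<in>D. c b *s (b - L (g b))) \<in> W0"
      using W vec.subspace_add by blast
    then have "(\<Sum>b\<in>D. c b *s b) \<in> vec.span B0"
      by (simp add: span0 vec.scale_right_diff_distrib sum_subtractf)
    then obtain d where d: "(\<Sum>b\<in>D. c b *s b) = (\<Sum>b\<in>B0. d b *s b)"
      using vec.span_finite[of B0] fin B1(1) finite_subset by (metis (no_types, lifting) imageE)
    define e where "e b = (if b \<in> D then c b else - d b)" for b
    have "B1 = D \<union> B0" "D \<inter> B0 = {}" using B1 by (auto simp: D_def)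
    then have "(\<Sum>b\<in>B1. e b *s b) = (\<Sum>b\<in>D. e b *s b) + (\<Sum>b\<in>B0. e b *s b)"
      using fin by (simp add: sum.union_disjoint)
    also have "(\<Sum>b\<in>D. e b *s b) = (\<Sum>b\<in>D. c b *s b)"
      by (intro sum.cong) (simp_all add: e_def)
    also have "(\<Sum>b\<in>B0. e b *s b) = - (\<Sum>b\<in>B0. d b *s b)"
      using \<open>D \<inter> B0 = {}\<close> by (auto simp: e_def sum_negf[symmetric] intro!: sum.cong)
    finally have "(\<Sum>b\<in>B1. e b *s b) = 0" using d by simp
    then have "\<forall>b\<in>B1. e b = 0"
      using B1(3) fin vec.independentD by blast
    then show ?thesis by (auto simp: e_def D_def)
  qed
  have inj: "inj_on g D"
  proof (rule inj_onI, rule ccontr)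
    fix x z assume xz: "x \<in> D" "z \<in> D" "g x = g z" "x \<noteq> z"
    define c where "c b = (if b = x then 1 else if b = z then - 1 else 0 :: 'a)" for b
    have "(\<Sum>b\<in>D. scale (c b) (g b)) = (\<Sum>b\<in>{x, z}. scale (c b) (g b))"
      using xz finD by (intro sum.mono_neutral_right) (auto simp: c_def)
    also have "\<dots> = 0" using xz by (simp add: c_def)
    finally have "\<forall>b\<in>D. c b = 0" using key[of c] U by (simp add: subspace_0)
    then show False using xz by (auto simp: c_def)
  qed
  have "quotient_basis U V (g ` D)"
    unfolding quotient_basis_def
  proof (intro conjI ballI allI impI)
    show "g ` D \<subseteq> V" using g by (auto simp: D_def)
  next
    fix x assume x: "x \<in> V"
    then have "L x \<in> vec.span B1" using into B1 by blast
    then obtain d where d: "L x = (\<Sum>b\<in>B1. d b *s b)"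
      using vec.span_finite[OF fin] by (metis (no_types, lifting) imageE)
    define z where "z = (\<Sum>b\<in>D. scale (d b) (g b))"
    have "B1 = D \<union> B0" "D \<inter> B0 = {}" using B1 by (auto simp: D_def)
    then have "L x = (\<Sum>b\<in>D. d b *s b) + (\<Sum>b\<in>B0. d b *s b)"
      using fin d by (simp add: sum.union_disjoint)
    then have "L (x - z) = (\<Sum>b\<in>D. d b *s (b - L (g b))) + (\<Sum>b\<in>B0. d b *s b)"
      by (simp add: z_def L.diff L.sum L.scale vec.scale_right_diff_distrib sum_subtractf)
    also have "\<dots> \<in> W0"
      using W(1) g B0(1)
      by (intro vec.subspace_add vec.subspace_sum vec.subspace_scale) (auto simp: D_def)
    finally have "L (x - z) \<in> W0" .
    moreover have "z \<in> V"
      using V g by (auto simp: D_def z_def intro!: subspace_sum subspace_scale)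
    ultimately have "x - z \<in> U" using kernel V x subspace_diff by blast
    moreover have "z \<in> span (g ` D)"
      unfolding z_def by (intro span_sum span_scale span_base) auto
    ultimately show "\<exists>z\<in>span (g ` D). x - z \<in> U" by blast
  next
    fix F c b assume F: "finite F \<and> F \<subseteq> g ` D \<and> (\<Sum>b\<in>F. scale (c b) b) \<in> U" "b \<in> F"
    define c' where "c' b = (if g b \<in> F then c (g b) else 0)" for b
    have "(\<Sum>b\<in>D. scale (c' b) (g b)) = (\<Sum>b\<in>{b\<in>D. g b \<in> F}. scale (c (g b)) (g b))"
      using finD by (intro sum.mono_neutral_cong_right) (auto simp: c'_def)
    also have "\<dots> = (\<Sum>b\<in>g ` {b\<in>D. g b \<in> F}. scale (c b) b)"
      using inj by (subst sum.reindex) (auto intro: inj_on_subset)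
    also have "g ` {b\<in>D. g b \<in> F} = F" using F by auto
    finally have "\<forall>b\<in>D. c' b = 0" using key[of c'] F by simp
    moreover obtain d where "d \<in> D" "b = g d" using F by blast
    ultimately show "c b = 0" using F by (auto simp: c'_def)
  qed
  then have "quotient_dim U V = card D"
    using quotient_dim_eq_card[OF U] inj by (simp add: card_image)
  also have "\<dots> = card B1 - card B0"
    using B1(1) fin by (simp add: D_def card_Diff_subset finite_subset)
  finally show ?thesis by (simp add: dims)
qed

section \<open>Evaluation and dehomogenisation\<close>

text \<open>With an order on the variables the polynomial ring becomes an integral domain, by the order
on exponent vectors that this induces.\<close>

instantiation var :: linorder
begin

fun var_rank :: "var \<Rightarrow> nat" where
  "var_rank Var_s = 0" | "var_rank Var_t = 1" | "var_rank Var_u = 2" | "var_rank Var_v = 3"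

definition less_eq_var :: "var \<Rightarrow> var \<Rightarrow> bool" where "x \<le> y \<longleftrightarrow> var_rank x \<le> var_rank y"
definition less_var :: "var \<Rightarrow> var \<Rightarrow> bool" where "x < y \<longleftrightarrow> var_rank x < var_rank y"

instance
proof
  fix x y :: var
  assume "x \<le> y" "y \<le> x"
  then show "x = y" by (cases x; cases y) (simp_all add: less_eq_var_def)
qed (auto simp: less_eq_var_def less_var_def)

end

lemma bipoly_induct [case_names zero single add]:
  assumes "P 0" "\<And>m c. P (Poly_Mapping.single m c)" "\<And>p q. P p \<Longrightarrow> P q \<Longrightarrow> P (p + q)"
  shows "P (p :: 'a \<Rightarrow>\<^sub>0 'b::comm_monoid_add)"
proof -
  have "p = (\<Sum>m\<in>Poly_Mapping.keys p. Poly_Mapping.single m (Poly_Mapping.lookup p m))"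
    by (rule poly_mapping_eqI)
      (auto simp: lookup_sum lookup_single when_def sum.delta' in_keys_iff)
  moreover have "P (\<Sum>m\<in>A. Poly_Mapping.single m (Poly_Mapping.lookup p m))" if "finite A" for A
    using that by (induction A) (auto intro: assms)
  ultimately show ?thesis by (metis finite_keys)
qed

definition monomial :: "nat \<Rightarrow> nat \<Rightarrow> nat \<Rightarrow> nat \<Rightarrow> (var \<Rightarrow>\<^sub>0 nat)" where
  "monomial a b c d = Poly_Mapping.single Var_s a + Poly_Mapping.single Var_t b +
     Poly_Mapping.single Var_u c + Poly_Mapping.single Var_v d"

lemma lookup_monomial [simp]:
  "Poly_Mapping.lookup (monomial a b c d) Var_s = a"
      "Poly_Mapping.lookup (monomial a b c d) Var_t = b"
  "Poly_Mapping.lookup (monomial a b c d) Var_u = c"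
      "Poly_Mapping.lookup (monomial a b c d) Var_v = d"
  by (simp_all add: monomial_def lookup_add lookup_single when_def)

lemma monomial_lookup: "monomial (Poly_Mapping.lookup m Var_s) (Poly_Mapping.lookup m Var_t)
    (Poly_Mapping.lookup m Var_u) (Poly_Mapping.lookup m Var_v) = m"
proof (rule poly_mapping_eqI)
  fix x show "Poly_Mapping.lookup (monomial (Poly_Mapping.lookup m Var_s) (Poly_Mapping.lookup m
      Var_t)
    (Poly_Mapping.lookup m Var_u) (Poly_Mapping.lookup m Var_v)) x = Poly_Mapping.lookup m x"
    by (cases x) simp_all
qed

text \<open>Substitution of ring elements for the variables, along a map of the scalars.\<close>

definition eval_bipoly :: "('k::field \<Rightarrow> 'r::comm_ring_1) \<Rightarrow> 'r \<Rightarrow> 'r \<Rightarrow> 'r \<Rightarrow> 'r \<Rightarrow> 'k bipoly \<Rightarrow> 'r" where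
  "eval_bipoly \<kappa> s t u v p = (\<Sum>m\<in>Poly_Mapping.keys p. \<kappa> (Poly_Mapping.lookup p m) *
     (s ^ Poly_Mapping.lookup m Var_s * t ^ Poly_Mapping.lookup m Var_t *
      u ^ Poly_Mapping.lookup m Var_u * v ^ Poly_Mapping.lookup m Var_v))"

locale scalar_hom =
  fixes \<kappa> :: "'k::field \<Rightarrow> 'r::comm_ring_1"
  assumes add: "\<kappa> (a + b) = \<kappa> a + \<kappa> b" and mult: "\<kappa> (a * b) = \<kappa> a * \<kappa> b" and one: "\<kappa> 1 = 1"
begin

lemma zero: "\<kappa> 0 = 0"
  using add[of 0 0] by simp

abbreviation "ev \<equiv> eval_bipoly \<kappa>"

lemma eval_superset:
  assumes "finite A" "Poly_Mapping.keys p \<subseteq> A"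
  shows "ev s t u v p = (\<Sum>m\<in>A. \<kappa> (Poly_Mapping.lookup p m) *
     (s ^ Poly_Mapping.lookup m Var_s * t ^ Poly_Mapping.lookup m Var_t *
      u ^ Poly_Mapping.lookup m Var_u * v ^ Poly_Mapping.lookup m Var_v))"
  unfolding eval_bipoly_def
  by (rule sum.mono_neutral_left) (use assms in \<open>auto simp: in_keys_iff zero\<close>)

lemma eval_zero [simp]: "ev s t u v 0 = 0"
  by (simp add: eval_bipoly_def)

lemma eval_single [simp]: "ev s t u v (Poly_Mapping.single m c) = \<kappa> c *
     (s ^ Poly_Mapping.lookup m Var_s * t ^ Poly_Mapping.lookup m Var_t *
      u ^ Poly_Mapping.lookup m Var_u * v ^ Poly_Mapping.lookup m Var_v)"
  by (simp add: eval_superset[of "{m}"])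

lemma eval_add [simp]: "ev s t u v (p + q) = ev s t u v p + ev s t u v q"
proof -
  let ?A = "Poly_Mapping.keys p \<union> Poly_Mapping.keys q"
  show ?thesis
    using eval_superset[of ?A p s t u v] eval_superset[of ?A q s t u v]
      eval_superset[of ?A "p + q" s t u v] Poly_Mapping.keys_add[of p q]
    by (simp add: lookup_add add distrib_right sum.distrib)
qed

lemma eval_uminus [simp]: "ev s t u v (- p) = - ev s t u v p"
  using eval_add[of s t u v "- p" p] by (simp add: eq_neg_iff_add_eq_0)

lemma eval_diff [simp]: "ev s t u v (p - q) = ev s t u v p - ev s t u v q"
  using eval_add[of s t u v p "- q"] by simp

lemma eval_mult [simp]: "ev s t u v (p * q) = ev s t u v p * ev s t u v q"
proof (induction p rule: bipoly_induct)
  case (single m c)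
  show ?case
  proof (induction q rule: bipoly_induct)
    case (single m' c')
    show ?case by (simp add: mult_single mult lookup_add power_add mult_ac)
  qed (simp_all add: distrib_left)
qed (simp_all add: distrib_right)

lemma eval_one [simp]: "ev s t u v 1 = 1"
  using eval_single[of s t u v 0 1] by (simp add: one)

lemma eval_power [simp]: "ev s t u v (p ^ k) = ev s t u v p ^ k"
  by (induction k) simp_all

lemma eval_sum: "ev s t u v (sum f A) = (\<Sum>i\<in>A. ev s t u v (f i))"
  by (induction A rule: infinite_finite_induct) simp_all

lemma eval_Const [simp]: "ev s t u v (Const c) = \<kappa> c"
  by (simp add: Const_def)

lemma eval_Var [simp]:
  "ev s t u v (Var Var_s) = s" "ev s t u v (Var Var_t) = t"
  "ev s t u v (Var Var_u) = u" "ev s t u v (Var Var_v) = v"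
  by (simp_all add: Var_def lookup_single one)

end

definition bideg :: "(var \<Rightarrow>\<^sub>0 nat) \<Rightarrow> int \<times> int" where
  "bideg m = (int (Poly_Mapping.lookup m Var_s + Poly_Mapping.lookup m Var_t),
     int (Poly_Mapping.lookup m Var_u + Poly_Mapping.lookup m Var_v))"

lemma graded_part_altdef: "graded_part a = {p. \<forall>m. Poly_Mapping.lookup p m \<noteq> 0 \<longrightarrow> bideg m = a}"
  by (auto simp: graded_part_def bideg_def in_keys_iff prod_eq_iff)

lemma bideg_add: "bideg (m + m') = bideg m + bideg m'"
  by (simp add: bideg_def lookup_add)

lemma graded_part_add: "p \<in> graded_part a \<Longrightarrow> q \<in> graded_part a \<Longrightarrow> p + q \<in> graded_part a"
  by (simp add: graded_part_altdef lookup_add) (metis add.left_neutral)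

lemma graded_part_diff: "p \<in> graded_part a \<Longrightarrow> q \<in> graded_part a \<Longrightarrow> p - q \<in> graded_part a"
  by (simp add: graded_part_altdef lookup_minus) (metis diff_0_right)

lemma graded_part_0 [simp]: "0 \<in> graded_part a"
  by (simp add: graded_part_def)

lemma graded_part_sum: "(\<And>i. i \<in> A \<Longrightarrow> f i \<in> graded_part a) \<Longrightarrow> sum f A \<in> graded_part a"
  by (induction A rule: infinite_finite_induct) (auto intro: graded_part_add)

lemma graded_part_single: "bideg m = a \<Longrightarrow> Poly_Mapping.single m c \<in> graded_part a"
  by (auto simp: graded_part_altdef lookup_single when_def)

lemma graded_part_mult:
  assumes "p \<in> graded_part a" "q \<in> graded_part b"
  shows "p * q \<in> graded_part (a + b)"
proof -
  have "bideg m = a + b" if m: "m \<in> Poly_Mapping.keys (p * q)" for m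
  proof -
    obtain m1 m2 where "m = m1 + m2" "m1 \<in> Poly_Mapping.keys p" "m2 \<in> Poly_Mapping.keys q"
      using m keys_mult[of p q] by blast
    then show ?thesis
      using assms by (simp add: graded_part_altdef in_keys_iff bideg_add)
  qed
  then show ?thesis by (simp add: graded_part_altdef in_keys_iff)
qed

lemma Var_graded [simp]:
  "Var Var_s \<in> graded_part (1, 0)" "Var Var_t \<in> graded_part (1, 0)"
  "Var Var_u \<in> graded_part (0, 1)" "Var Var_v \<in> graded_part (0, 1)"
  by (simp_all add: Var_def graded_part_single bideg_def lookup_single when_def)

lemma Const_graded [simp]: "Const c \<in> graded_part (0, 0)"
  by (simp add: Const_def graded_part_single bideg_def)

text \<open>The two variables per factor are replaced by one: \<open>s\<close> is the outer and \<open>u\<close> the inner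
polynomial variable.\<close>

definition dehom :: "'k::field bipoly \<Rightarrow> 'k poly poly" where
  "dehom = eval_bipoly (\<lambda>c. [:[:c:]:]) [:0, 1:] 1 [:[:0, 1:]:] 1"

interpretation dehom: scalar_hom "\<lambda>c :: 'k::field. [:[:c:]:]"
  by unfold_locales (simp_all add: one_pCons)

lemma dehom_simps [simp]:
  "dehom 0 = 0" "dehom 1 = 1" "dehom (p + q) = dehom p + dehom q"
      "dehom (p - q) = dehom p - dehom q"
  "dehom (p * q) = dehom p * dehom q" "dehom (p ^ k) = dehom p ^ k" "dehom (- p) = - dehom p"
  "dehom (Const c) = [:[:c:]:]" "dehom (Var Var_s) = [:0, 1:]" "dehom (Var Var_t) = 1"
  "dehom (Var Var_u) = [:[:0, 1:]:]" "dehom (Var Var_v) = 1"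
  by (simp_all add: dehom_def)

lemma dehom_sum: "dehom (sum f A) = (\<Sum>i\<in>A. dehom (f i))"
  unfolding dehom_def by (rule dehom.eval_sum)

text \<open>In a fixed bidegree nothing is lost, since the exponents of \<open>t\<close> and \<open>v\<close> are determined by
those of \<open>s\<close> and \<open>u\<close>.\<close>

lemma coeff_dehom:
  assumes "p \<in> graded_part (int i, int e)"
  shows "coeff (coeff (dehom p) j) k =
    (if j \<le> i \<and> k \<le> e then Poly_Mapping.lookup p (monomial j (i - j) k (e - k)) else 0)"
proof -
  have x: "[:0, 1:] ^ j = monom 1 j" for j
    by (simp add: monom_altdef)
  have y: "[:[:0, 1:]:] ^ k = [:monom 1 k:]" for k
    by (induction k) (simp_all add: monom_Suc)
  have "dehom p = (\<Sum>m\<in>Poly_Mapping.keys p. monom (monom (Poly_Mapping.lookup p m)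
      (Poly_Mapping.lookup m Var_u)) (Poly_Mapping.lookup m Var_s))"
    unfolding dehom_def eval_bipoly_def
    by (intro sum.cong refl) (simp add: x y smult_monom mult.commute)
  then have "coeff (coeff (dehom p) j) k = (\<Sum>m\<in>Poly_Mapping.keys p.
      if Poly_Mapping.lookup m Var_s = j \<and> Poly_Mapping.lookup m Var_u =
          k then Poly_Mapping.lookup p m else 0)"
    by (simp add: coeff_sum) (intro sum.cong refl, simp)
  also have "\<dots> = (\<Sum>m\<in>Poly_Mapping.keys p. if m = monomial j (i - j) k (e - k)
      then (if j \<le> i \<and> k \<le> e then Poly_Mapping.lookup p m else 0) else 0)"
  proof (intro sum.cong refl)
    fix m assume m: "m \<in> Poly_Mapping.keys p"
    then have "bideg m = (int i, int e)"
      using assms by (simp add: graded_part_altdef in_keys_iff)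
    then have "Poly_Mapping.lookup m Var_s + Poly_Mapping.lookup m Var_t = i"
      "Poly_Mapping.lookup m Var_u + Poly_Mapping.lookup m Var_v = e"
      by (simp_all add: bideg_def)
    then have "Poly_Mapping.lookup m Var_s = j \<and> Poly_Mapping.lookup m Var_u = k \<longleftrightarrow>
        j \<le> i \<and> k \<le> e \<and> m = monomial j (i - j) k (e - k)"
      using monomial_lookup[of m] lookup_monomial by (metis add_diff_cancel_left' le_add1)
    then show "(if Poly_Mapping.lookup m Var_s = j \<and> Poly_Mapping.lookup m Var_u =
        k then Poly_Mapping.lookup p m else 0) =
      (if m = monomial j (i - j) k (e - k) then (if j \<le> i \<and>
          k \<le> e then Poly_Mapping.lookup p m else 0) else 0)"
      by auto
  qed
  also have "\<dots> = (if j \<le> i \<and>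
      k \<le> e then Poly_Mapping.lookup p (monomial j (i - j) k (e - k)) else 0)"
    by (auto simp: in_keys_iff)
  finally show ?thesis .
qed

definition homogenise :: "nat \<Rightarrow> nat \<Rightarrow> 'k::field poly poly \<Rightarrow> 'k bipoly" where
  "homogenise i e P = (\<Sum>j\<le>i. \<Sum>k\<le>e. Poly_Mapping.single (monomial j (i - j) k (e - k)) (coeff
      (coeff P j) k))"

lemma homogenise_graded: "homogenise i e P \<in> graded_part (int i, int e)"
  unfolding homogenise_def
      by (intro graded_part_sum graded_part_single) (simp add: bideg_def of_nat_diff)

lemma dehom_inj:
  assumes "p \<in> graded_part (int i, int e)" "dehom p = 0"
  shows "p = 0"
proof (rule poly_mapping_eqI)
  fix m
  show "Poly_Mapping.lookup p m = Poly_Mapping.lookup 0 m"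
  proof (rule ccontr)
    assume neq: "Poly_Mapping.lookup p m \<noteq> Poly_Mapping.lookup 0 m"
    then have "bideg m = (int i, int e)" using assms(1) by (simp add: graded_part_altdef)
    then have *: "Poly_Mapping.lookup m Var_s \<le> i" "Poly_Mapping.lookup m Var_u \<le> e"
      "Poly_Mapping.lookup m Var_t = i - Poly_Mapping.lookup m Var_s"
      "Poly_Mapping.lookup m Var_v = e - Poly_Mapping.lookup m Var_u"
      by (simp_all add: bideg_def) linarith+
    then have "monomial (Poly_Mapping.lookup m Var_s) (i - Poly_Mapping.lookup m Var_s)
        (Poly_Mapping.lookup m Var_u) (e - Poly_Mapping.lookup m Var_u) = m"
      using monomial_lookup[of m] by simp
    then show False
      using coeff_dehom[OF assms(1), of "Poly_Mapping.lookup m Var_s"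
          "Poly_Mapping.lookup m Var_u"] * neq assms(2)
      by simp
  qed
qed

lemma dehom_eqD:
  "p \<in> graded_part (int i, int e) \<Longrightarrow> q \<in> graded_part (int i, int e) \<Longrightarrow> dehom p = dehom q \<Longrightarrow> p = q"
  using dehom_inj[of "p - q" i e] by (simp add: graded_part_diff)

lemma coeff_homogenise:
  "coeff (coeff (dehom (homogenise i e P)) j) k = (if j \<le> i \<and>
      k \<le> e then coeff (coeff P j) k else 0)"
proof -
  have x: "[:0, 1:] ^ j = monom 1 j" for j
    by (simp add: monom_altdef)
  have y: "[:[:0, 1:]:] ^ k = [:monom 1 k:]" for k
    by (induction k) (simp_all add: monom_Suc)
  have "dehom (Poly_Mapping.single (monomial j b k c) d) = monom (monom d k) j" for j b k c
      and d :: 'a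
    unfolding dehom_def
    by (simp add: x y smult_monom mult.commute)
  then have "dehom (homogenise i e P) = (\<Sum>j\<le>i. \<Sum>k\<le>e. monom (monom (coeff (coeff P j) k) k) j)"
    by (simp add: homogenise_def dehom_sum)
  moreover have "(\<Sum>k\<in>A. if b then f k else 0) = (if b then sum f A else 0)"
    for A b and f :: "nat \<Rightarrow> 'a"
    by simp
  ultimately show ?thesis
    by (simp add: coeff_sum if_distrib[of "\<lambda>p. coeff p _"] cong: if_cong)
qed

lemma dehom_homogenise:
  assumes "\<And>j k. coeff (coeff P j) k \<noteq> 0 \<Longrightarrow> j \<le> i \<and> k \<le> e"
  shows "dehom (homogenise i e P) = P"
  by (intro poly_eqI) (use assms in \<open>auto simp: coeff_homogenise\<close>)

section \<open>Bihomogeneous components\<close>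

definition bicomp :: "int \<times> int \<Rightarrow> 'k::field bipoly \<Rightarrow> 'k bipoly" where
  "bicomp a p = (\<Sum>m\<in>{m \<in> Poly_Mapping.keys p. bideg m = a}.
     Poly_Mapping.single m (Poly_Mapping.lookup p m))"

lemma lookup_bicomp:
  "Poly_Mapping.lookup (bicomp a p) m = (if bideg m = a then Poly_Mapping.lookup p m else 0)"
  by (auto simp: bicomp_def lookup_sum lookup_single when_def in_keys_iff)

lemma bicomp_graded [simp]: "bicomp a p \<in> graded_part a"
  by (simp add: graded_part_altdef lookup_bicomp)

lemma bicomp_add [simp]: "bicomp a (p + q) = bicomp a p + bicomp a q"
  by (rule poly_mapping_eqI) (simp add: lookup_bicomp lookup_add)

lemma bicomp_0 [simp]: "bicomp a 0 = 0"
  by (rule poly_mapping_eqI) (simp add: lookup_bicomp)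

lemma bicomp_of_graded:
  assumes "p \<in> graded_part b"
  shows "bicomp a p = (if a = b then p else 0)"
  by (rule poly_mapping_eqI) (use assms in \<open>auto simp: lookup_bicomp graded_part_altdef\<close>)

text \<open>It suffices to check this for a monomial \<open>p\<close>, where both sides are \<open>p x\<close> or both are \<open>0\<close>.\<close>

lemma bicomp_mult:
  assumes "x \<in> graded_part b"
  shows "bicomp a (p * x) = bicomp (a - b) p * x"
proof (induction p rule: bipoly_induct)
  case (single m c)
  have m: "Poly_Mapping.single m c \<in> graded_part (bideg m)"
    by (simp add: graded_part_single)
  then have "Poly_Mapping.single m c * x \<in> graded_part (bideg m + b)"
    using assms graded_part_mult by blast
  then have "bicomp a (Poly_Mapping.single m c * x) =
      (if a = bideg m + b then Poly_Mapping.single m c * x else 0)"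
    by (rule bicomp_of_graded)
  then show ?case
    by (simp add: bicomp_of_graded[OF m] diff_eq_eq)
qed (simp_all add: distrib_right)

lemma mult_bicomp:
  "x \<in> graded_part b \<Longrightarrow> bicomp a (x * p) = x * bicomp (a - b) p"
  using bicomp_mult[of x b a p] by (simp add: mult.commute)

section \<open>The syzygy module\<close>

lemma mem_Syz: "g \<in> Syz f \<longleftrightarrow> dot g f = 0"
  by (simp add: Syz_def dot_def)

lemma subspace_Syz: "free_module.subspace (Syz f)"
  by (rule free_module.subspaceI) (simp_all add: mem_Syz dot_linear)

lemmas Syz_add = free_module.subspace_add[OF subspace_Syz]
  and Syz_diff = free_module.subspace_diff[OF subspace_Syz]
  and Syz_smult = free_module.subspace_scale[OF subspace_Syz]

lemma koszul_in_Syz: "cross a f \<in> Syz f"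
  by (simp add: mem_Syz)

lemma Var_irrelevant: "Var x \<in> irrelevant"
  unfolding irrelevant_def ideal_gen_def by (cases x) (simp_all add: ring_module.span_base)

lemma Var_smult_in_m_Syz: "g \<in> Syz f \<Longrightarrow> Var x *s g \<in> m_Syz f"
  unfolding m_Syz_def using Var_irrelevant by (intro free_module.span_base) blast

lemma subspace_m_Syz: "free_module.subspace (m_Syz f)"
  unfolding m_Syz_def by (rule free_module.subspace_span)

lemma m_SyzE:
  assumes "g \<in> m_Syz f"
  obtains a b c d where "a \<in> Syz f" "b \<in> Syz f" "c \<in> Syz f" "d \<in> Syz f"
    "g = Var Var_s *s a + Var Var_t *s b + Var Var_u *s c + Var Var_v *s d"
proof -
  define D where "D = {Var Var_s *s a + Var Var_t *s b + Var Var_u *s c + Var Var_v *s d |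
     a b c d. a \<in> Syz f \<and> b \<in> Syz f \<and> c \<in> Syz f \<and> d \<in> Syz f}"
  have D_I: "x \<in> D" if "a \<in> Syz f" "b \<in> Syz f" "c \<in> Syz f" "d \<in> Syz f"
    "x = Var Var_s *s a + Var Var_t *s b + Var Var_u *s c + Var Var_v *s d" for x a b c d
    unfolding D_def by (intro CollectI exI conjI) (rule that)+
  have D_E: thesis if "x \<in> D" "\<And>a b c d. a \<in> Syz f \<Longrightarrow> b \<in> Syz f \<Longrightarrow> c \<in> Syz f \<Longrightarrow>
      d \<in> Syz f \<Longrightarrow> x = Var Var_s *s a + Var Var_t *s b + Var Var_u *s c + Var Var_v *s d \<Longrightarrow> thesis"
    for x thesis
    using that(1) unfolding D_def by (elim CollectE exE conjE) (rule that(2))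
  have sub: "free_module.subspace D"
  proof (rule free_module.subspaceI)
    show "0 \<in> D"
      by (rule D_I[of 0 0 0 0]) (simp_all add: free_module.subspace_0[OF subspace_Syz])
  next
    fix x y assume "x \<in> D" "y \<in> D"
    obtain a b c d where x: "a \<in> Syz f" "b \<in> Syz f" "c \<in> Syz f" "d \<in> Syz f"
      "x = Var Var_s *s a + Var Var_t *s b + Var Var_u *s c + Var Var_v *s d"
      using \<open>x \<in> D\<close> by (rule D_E)
    obtain a' b' c' d' where y: "a' \<in> Syz f" "b' \<in> Syz f" "c' \<in> Syz f" "d' \<in> Syz f"
      "y = Var Var_s *s a' + Var Var_t *s b' + Var Var_u *s c' + Var Var_v *s d'"
      using \<open>y \<in> D\<close> by (rule D_E)
    have "x + y = Var Var_s *s (a + a') + Var Var_t *s (b + b') + Var Var_u *s (c + c') +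
        Var Var_v *s (d + d')"
      by (simp only: x y vector_add_ldistrib ac_simps)
    then show "x + y \<in> D"
      by (rule D_I[rotated 4]) (rule Syz_add; fact)+
  next
    fix r x assume "x \<in> D"
    then obtain a b c d where x: "a \<in> Syz f" "b \<in> Syz f" "c \<in> Syz f" "d \<in> Syz f"
      "x = Var Var_s *s a + Var Var_t *s b + Var Var_u *s c + Var Var_v *s d"
      by (rule D_E)
    have "r *s x = Var Var_s *s (r *s a) + Var Var_t *s (r *s b) + Var Var_u *s (r *s c) +
        Var Var_v *s (r *s d)"
      by (simp add: x vector_add_ldistrib vector_smult_assoc mult.commute)
    then show "r *s x \<in> D"
      by (rule D_I[rotated 4]) (rule Syz_smult; fact)+
  qed
  have "x *s g \<in> D" if x: "x \<in> irrelevant" and g: "g \<in> Syz f" for x g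
  proof -
    obtain k1 k2 k3 k4 where
        "x - k1 * Var Var_s - k2 * Var Var_t - k3 * Var Var_u - k4 * Var Var_v = 0"
      using x unfolding irrelevant_def ideal_gen_def ring_module.span_breakdown_eq by auto
    then have "x = k1 * Var Var_s + k2 * Var Var_t + k3 * Var Var_u + k4 * Var Var_v"
      by (simp add: algebra_simps)
    then have "x *s g = Var Var_s *s (k1 *s g) + Var Var_t *s (k2 *s g) + Var Var_u *s (k3 *s g) +
        Var Var_v *s (k4 *s g)"
      by (simp add: vector_sadd_rdistrib vector_smult_assoc mult.commute)
    then show "x *s g \<in> D"
      by (rule D_I[rotated 4]) (rule Syz_smult; fact)+
  qed
  then have "m_Syz f \<subseteq> D"
    unfolding m_Syz_def using sub by (intro free_module.span_minimal) auto
  then have "g \<in> D" using assms by (rule subsetD)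
  then show ?thesis by (rule D_E) (rule that)
qed

lemma Syz_bicomp:
  assumes "\<And>i. f $ i \<in> graded_part b" "g \<in> Syz f"
  shows "(\<chi> i. bicomp a (g $ i)) \<in> Syz f"
proof -
  have "dot (\<chi> i. bicomp a (g $ i)) f = bicomp (a + b) (dot g f)"
    using assms(1) by (simp add: dot_def sum_3 bicomp_mult[where b = b])
  then show ?thesis using assms(2) by (simp add: mem_Syz)
qed

text \<open>Taking bihomogeneous components in \<open>g = s a + t b + u c + v d\<close> shows that the four syzygies
may be taken bihomogeneous, of the expected bidegrees.\<close>

lemma m_Syz_gradedE:
  assumes f: "\<And>i. f $ i \<in> graded_part b" and "g \<in> m_Syz f" and g: "\<And>i. g $ i \<in> graded_part (i1, i2)"
  obtains a b c d where "a \<in> Syz f" "b \<in> Syz f" "c \<in> Syz f" "d \<in> Syz f"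
    "\<And>i. a $ i \<in> graded_part (i1 - 1, i2)" "\<And>i. b $ i \<in> graded_part (i1 - 1, i2)"
    "\<And>i. c $ i \<in> graded_part (i1, i2 - 1)" "\<And>i. d $ i \<in> graded_part (i1, i2 - 1)"
    "g = Var Var_s *s a + Var Var_t *s b + Var Var_u *s c + Var Var_v *s d"
proof -
  obtain a b c d where *: "a \<in> Syz f" "b \<in> Syz f" "c \<in> Syz f" "d \<in> Syz f"
    "g = Var Var_s *s a + Var Var_t *s b + Var Var_u *s c + Var Var_v *s d"
    using m_SyzE[OF assms(2)] by blast
  have "g $ i = bicomp (i1, i2) (g $ i)" for i
    using bicomp_of_graded[OF g] by simp
  also have "bicomp (i1, i2) (g $ i) = Var Var_s * bicomp (i1 - 1, i2) (a $ i) +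
      Var Var_t * bicomp (i1 - 1, i2) (b $ i) + Var Var_u * bicomp (i1, i2 - 1) (c $ i) +
      Var Var_v * bicomp (i1, i2 - 1) (d $ i)" for i
    by (simp add: *(5) mult_bicomp[OF Var_graded(1)] mult_bicomp[OF Var_graded(2)]
      mult_bicomp[OF Var_graded(3)] mult_bicomp[OF Var_graded(4)])
  finally have "g = Var Var_s *s (\<chi> i. bicomp (i1 - 1, i2) (a $ i)) +
      Var Var_t *s (\<chi> i. bicomp (i1 - 1, i2) (b $ i)) + Var Var_u *s (\<chi> i. bicomp (i1,
          i2 - 1) (c $ i)) +
      Var Var_v *s (\<chi> i. bicomp (i1, i2 - 1) (d $ i))"
    by (simp add: vec_eq_iff)
  note eq = this
  have in_Syz: "(\<chi> i. bicomp e (h $ i)) \<in> Syz f" if "h \<in> Syz f" for e h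
    using f that by (rule Syz_bicomp)
  show ?thesis
    by (rule that[OF in_Syz[OF *(1)] in_Syz[OF *(2)] in_Syz[OF *(3)] in_Syz[OF *(4)] _ _ _ _ eq])
      (simp_all only: vec_lambda_beta bicomp_graded)
qed

section \<open>Dehomogenised syzygies\<close>

text \<open>In bidegree \<open>(i, e)\<close> the vector \<open>slice j g\<close> carries the coefficient of \<open>s ^ j t ^ (i - j)\<close>.\<close>

definition slice :: "nat \<Rightarrow> 'k::field bipoly ^ 3 \<Rightarrow> 'k poly ^ 3" where
  "slice j g = (\<chi> i. coeff (dehom (g $ i)) j)"

lemma slice_nth [simp]: "slice j g $ i = coeff (dehom (g $ i)) j"
  by (simp add: slice_def)

lemma slice_linear [simp]:
  "slice j (g + h) = slice j g + slice j h" "slice j (g - h) = slice j g - slice j h"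
  "slice j 0 = 0" "slice j (Var Var_t *s g) = slice j g" "slice j (Var Var_v *s g) = slice j g"
  "slice j (Const c *s g) = [:c:] *s slice j g"
  by (simp_all add: vec_eq_iff)

lemma slice_Var_u [simp]: "slice j (Var Var_u *s g) = monom 1 1 *s slice j g"
  by (simp add: vec_eq_iff monom_altdef)

lemma slice_Var_u_power:
  fixes g :: "'k::field bipoly ^ 3"
  shows "slice j (Var Var_u ^ k *s g) = monom 1 k *s slice j g"
proof -
  have "dehom ((Var Var_u :: 'k bipoly) ^ k) = [:monom 1 k:]"
    by (induction k) (simp_all add: monom_Suc one_pCons)
  then have "dehom ((Var Var_u :: 'k bipoly) ^ k * p) = [:monom 1 k:] * dehom p" for p
      by (simp only: dehom_simps(5))
  then show ?thesis by (simp only: vec_eq_iff slice_nth vector_smult_component) simp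
qed

lemma slice_Var_s [simp]: "slice 0 (Var Var_s *s g) = 0"
    "slice (Suc j) (Var Var_s *s g) = slice j g"
  by (simp_all add: vec_eq_iff)

abbreviation graded_vec :: "nat \<Rightarrow> nat \<Rightarrow> 'k::field bipoly ^ 3 \<Rightarrow> bool" where
  "graded_vec i e g \<equiv> \<forall>k. g $ k \<in> graded_part (int i, int e)"

lemma coeff_dehom_eq_0:
  "graded_vec i e g \<Longrightarrow> i < j \<or> e < l \<Longrightarrow> coeff (coeff (dehom (g $ k)) j) l = 0"
  by (subst coeff_dehom[of _ i e]) auto

lemma vec_below_slice: "graded_vec i e g \<Longrightarrow> vec_below (Suc e) (slice j g)"
  using coeff_dehom_eq_0[where i = i and e = e and g = g] by (simp add: vec_below_def vec_eq_iff)

lemma dehom_graded_1: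
  assumes g: "graded_vec 1 e g"
  shows "dehom (g $ k) = [:slice 0 g $ k, slice 1 g $ k:]"
proof (rule poly_eqI)
  fix j
  show "coeff (dehom (g $ k)) j = coeff [:slice 0 g $ k, slice 1 g $ k:] j"
    using coeff_dehom_eq_0[OF g] by (cases j; cases "j - 1") (auto simp: poly_eq_iff)
qed

lemma dehom_graded_2:
  assumes g: "graded_vec 2 e g"
  shows "dehom (g $ k) = [:slice 0 g $ k, slice 1 g $ k, slice 2 g $ k:]"
proof (rule poly_eqI)
  fix j
  show "coeff (dehom (g $ k)) j = coeff [:slice 0 g $ k, slice 1 g $ k, slice 2 g $ k:] j"
  proof (cases "j \<le> 2")
    case True
    then have "j = 0 \<or> j = 1 \<or> j = 2" by auto
    then show ?thesis by (auto simp: numeral_2_eq_2)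
  next
    case False
    then have "coeff (dehom (g $ k)) j = 0"
      using coeff_dehom_eq_0[OF g] by (simp add: poly_eq_iff)
    then show ?thesis using False by (cases j; cases "j - 1"; cases "j - 2") auto
  qed
qed

lemma graded_vec_eqI:
  assumes "graded_vec 2 e g" "graded_vec 2 e h" "slice 0 g = slice 0 h" "slice 1 g = slice 1 h"
    "slice 2 g = slice 2 h"
  shows "g = h"
  unfolding vec_eq_iff
proof
  fix k
  have "dehom (g $ k) = dehom (h $ k)"
    by (simp only: dehom_graded_2[OF assms(1)] dehom_graded_2[OF assms(2)] assms(3-5))
  then show "g $ k = h $ k"
    using assms(1,2) dehom_eqD by blast
qed

lemma graded_vec_1_eq_0:
  assumes "graded_vec 1 e g" "slice 0 g = 0" "slice 1 g = 0"
  shows "g = 0"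
  unfolding vec_eq_iff
proof
  fix k
  have "dehom (g $ k) = 0"
    by (simp only: dehom_graded_1[OF assms(1)] assms(2,3)) simp
  then show "g $ k = 0 $ k"
    using assms(1) dehom_inj by (metis zero_index)
qed

lemma Syz_1_dest:
  assumes f: "graded_vec 1 n f" and g: "graded_vec 1 e g" and "g \<in> Syz f"
  shows "dot (slice 0 g) (slice 0 f) = 0"
    "dot (slice 0 g) (slice 1 f) + dot (slice 1 g) (slice 0 f) = 0"
    "dot (slice 1 g) (slice 1 f) = 0"
proof -
  have "0 = dehom (dot g f)" using assms(3) by (simp add: mem_Syz)
  also have "\<dots> = [:dot (slice 0 g) (slice 0 f),
     dot (slice 0 g) (slice 1 f) + dot (slice 1 g) (slice 0 f), dot (slice 1 g) (slice 1 f):]"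
    unfolding dot_def dehom_sum dehom_simps dehom_graded_1[OF f] dehom_graded_1[OF g] sum_3
    by (simp add: algebra_simps)
  finally show "dot (slice 0 g) (slice 0 f) = 0"
    "dot (slice 0 g) (slice 1 f) + dot (slice 1 g) (slice 0 f) = 0"
    "dot (slice 1 g) (slice 1 f) = 0"
    by (simp_all only: pCons_eq_0_iff eq_commute[of "0 :: _ poly poly"] simp_thms)
qed

lemma Syz_2_iff:
  assumes f: "graded_vec 1 n f" and g: "graded_vec 2 e g"
  shows "g \<in> Syz f \<longleftrightarrow> quadratic_syzygy (slice 1 f) (slice 0 f) (slice 0 g) (slice 1 g) (slice 2 g)"
proof -
  have "dehom (dot g f) = [:dot (slice 0 g) (slice 0 f),
     dot (slice 0 g) (slice 1 f) + dot (slice 1 g) (slice 0 f),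
     dot (slice 1 g) (slice 1 f) + dot (slice 2 g) (slice 0 f), dot (slice 2 g) (slice 1 f):]"
    unfolding dot_def dehom_sum dehom_simps dehom_graded_1[OF f] dehom_graded_2[OF g] sum_3
    by (simp add: algebra_simps)
  moreover have "dot g f \<in> graded_part (int 3, int (e + n))"
    unfolding dot_def
  proof (intro graded_part_sum)
    fix i
    have "g $ i * f $ i \<in> graded_part ((int 2, int e) + (int 1, int n))"
      using f g by (intro graded_part_mult) auto
    then show "g $ i * f $ i \<in> graded_part (int 3, int (e + n))" by simp
  qed
  then have "dot g f = 0 \<longleftrightarrow> dehom (dot g f) = 0" using dehom_inj by fastforce
  ultimately show ?thesis by (simp add: mem_Syz quadratic_syzygy_def)
qed

lemma ex_graded_vec:
  assumes "vec_below (Suc e) g0" "vec_below (Suc e) g1" "vec_below (Suc e) g2"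
  obtains g where "graded_vec 2 e g" "slice 0 g = g0" "slice 1 g = g1" "slice 2 g = g2"
proof
  let ?g = "\<chi> i. homogenise 2 e [:g0 $ i, g1 $ i, g2 $ i:]"
  have c: "coeff (v $ i) k = 0" if "vec_below (Suc e) v" "\<not> k \<le> e" for v :: "'a poly ^ 3" and i k
    using that by (auto simp: vec_below_def vec_eq_iff)
  show "graded_vec 2 e ?g" by (simp only: vec_lambda_beta homogenise_graded simp_thms)
  show "slice 0 ?g = g0" "slice 1 ?g = g1" "slice 2 ?g = g2"
    unfolding vec_eq_iff slice_nth vec_lambda_beta poly_eq_iff coeff_homogenise
    using c[OF assms(1)] c[OF assms(2)] c[OF assms(3)] by (auto simp: numeral_2_eq_2)
qed

text \<open>The bidegree \<open>(3, n + e)\<close> of a syzygy corresponds to entries of bidegree \<open>(2, e)\<close>.\<close>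

lemma Syz_part_iff:
  "g \<in> Syz_part n f (3, int (n + e)) \<longleftrightarrow> g \<in> Syz f \<and> graded_vec 2 e g"
  by (simp add: Syz_part_def)

lemma graded_vec_smult:
  assumes "x \<in> graded_part (int a, int b)" "graded_vec i e g"
  shows "graded_vec (a + i) (b + e) (x *s g)"
proof
  fix k
  have "x * g $ k \<in> graded_part ((int a, int b) + (int i, int e))"
    using assms by (intro graded_part_mult) auto
  then show "(x *s g) $ k \<in> graded_part (int (a + i), int (b + e))" by simp
qed

lemma graded_vec_Var:
  assumes "graded_vec i e g"
  shows "graded_vec (Suc i) e (Var Var_s *s g)" "graded_vec (Suc i) e (Var Var_t *s g)"
    "graded_vec i (Suc e) (Var Var_u *s g)" "graded_vec i (Suc e) (Var Var_v *s g)"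
  using graded_vec_smult[of _ 1 0, OF _ assms] graded_vec_smult[of _ 0 1, OF _ assms] by simp_all

lemma graded_vec_add: "graded_vec i e g \<Longrightarrow> graded_vec i e h \<Longrightarrow> graded_vec i e (g + h)"
  by (simp add: graded_part_add)

lemma graded_vec_diff: "graded_vec i e g \<Longrightarrow> graded_vec i e h \<Longrightarrow> graded_vec i e (g - h)"
  by (simp add: graded_part_diff)

lemma graded_vec_Var_u_power:
  assumes "graded_vec i e g"
  shows "graded_vec i (k + e) (Var Var_u ^ k *s g)"
proof (induction k)
  case (Suc k)
  then show ?case using graded_vec_Var(3)[OF Suc] by (simp add: vector_smult_assoc)
qed (use assms in simp)

section \<open>Minimal syzygies of degree three in the first variables\<close>

locale bihom_pencil = pencil n "slice 1 f" "slice 0 f" y y'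
  for n :: nat and f :: "'k::field bipoly ^ 3" and y y' +
  assumes graded: "graded_vec 1 n f"
begin

abbreviation "p \<equiv> slice 1 f"
abbreviation "q \<equiv> slice 0 f"

lemma Syz_iff: "graded_vec 2 e g \<Longrightarrow> g \<in> Syz f
    \<longleftrightarrow> quadratic_syzygy p q (slice 0 g) (slice 1 g) (slice 2 g)"
  by (rule Syz_2_iff[OF graded])

lemma ex_syzygy:
  assumes "quadratic_syzygy p q g0 g1 g2" "vec_below (Suc e) g0" "vec_below (Suc e) g1"
      "vec_below (Suc e) g2"
  obtains g where "g \<in> Syz f" "graded_vec 2 e g" "slice 0 g = g0" "slice 1 g = g1" "slice 2 g = g2"
  using ex_graded_vec[OF assms(2-4)] Syz_iff assms(1) by metis

text \<open>A syzygy that loses its leading coefficient is divisible by \<open>v\<close>.\<close>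

lemma divide_v:
  assumes "g \<in> Syz f" "graded_vec 2 (Suc e) g" and
    "vec_coeff (Suc e) (slice 0 g) = 0" "vec_coeff (Suc e) (slice 1 g) = 0"
        "vec_coeff (Suc e) (slice 2 g) = 0"
  obtains h where "h \<in> Syz f" "graded_vec 2 e h" "g = Var Var_v *s h"
proof -
  have below: "vec_below (Suc e) (slice 0 g)" "vec_below (Suc e) (slice 1 g)"
      "vec_below (Suc e) (slice 2 g)"
    using assms vec_below_slice[OF assms(2)] vec_below_drop by blast+
  obtain h where h: "h \<in> Syz f" "graded_vec 2 e h"
    "slice 0 h = slice 0 g" "slice 1 h = slice 1 g" "slice 2 h = slice 2 g"
    using ex_syzygy[OF _ below] Syz_iff[OF assms(2)] assms(1) by blast
  have "g = Var Var_v *s h"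
    by (rule graded_vec_eqI[OF assms(2) graded_vec_Var(4)[OF h(2)]]) (simp_all only: h slice_linear)
  then show ?thesis using that h by blast
qed

text \<open>The multiplier that the Koszul formula gives over the point at infinity.\<close>

definition lead :: "nat \<Rightarrow> 'k bipoly ^ 3 \<Rightarrow> 'k ^ (3 + 3)" where
  "lead e g = pair_vec (cross (cross y' p\<^sub>n) (vec_coeff e (slice 0 g)))
     (cross (cross y' p\<^sub>n) (vec_coeff e (slice 1 g)) - dot y' (vec_coeff e (slice 2 g)) *s q\<^sub>n)"

lemma lead_eq:
  assumes "g \<in> Syz f" "graded_vec 2 e g"
  obtains a0 a1 where "lead e g = pair_vec a0 a1" "cross a0 q\<^sub>n = vec_coeff e (slice 0 g)"
    "cross a0 p\<^sub>n + cross a1 q\<^sub>n = vec_coeff e (slice 1 g)" "cross a1 p\<^sub>n = vec_coeff e (slice 2 g)"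
proof -
  note top = coeff_dot_top[OF vec_below_slice[OF assms(2)] below(1)]
    coeff_dot_top[OF vec_below_slice[OF assms(2)] below(2)]
  have "quadratic_syzygy p q (slice 0 g) (slice 1 g) (slice 2 g)" using Syz_iff assms by blast
  then have "dot (slice 0 g) q = 0" "dot (slice 0 g) p + dot (slice 1 g) q = 0"
    "dot (slice 1 g) p + dot (slice 2 g) q = 0" "dot (slice 2 g) p = 0"
    unfolding quadratic_syzygy_def by blast+
  from this[THEN arg_cong[where f = "\<lambda>x. coeff x (e + n)"]]
  have "dot (vec_coeff e (slice 0 g)) q\<^sub>n = 0"
    "dot (vec_coeff e (slice 0 g)) p\<^sub>n + dot (vec_coeff e (slice 1 g)) q\<^sub>n = 0"
    "dot (vec_coeff e (slice 1 g)) p\<^sub>n + dot (vec_coeff e (slice 2 g)) q\<^sub>n = 0"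
    "dot (vec_coeff e (slice 2 g)) p\<^sub>n = 0"
    by (simp_all only: coeff_add coeff_0 top)
  from koszul_quadratic[OF y' this] show ?thesis
    by (rule that[rotated]) (simp add: lead_def)
qed

lemma lead_mem_lead_space_Suc:
  assumes "g \<in> Syz f" "graded_vec 2 e g"
  shows "lead e g \<in> lead_space (Suc e)"
proof -
  obtain a0 a1 where a: "lead e g = pair_vec a0 a1" "cross a0 q\<^sub>n = vec_coeff e (slice 0 g)"
    "cross a0 p\<^sub>n + cross a1 q\<^sub>n = vec_coeff e (slice 1 g)" "cross a1 p\<^sub>n = vec_coeff e (slice 2 g)"
    using lead_eq[OF assms] by blast
  show ?thesis
    unfolding a(1)
    by (rule lead_spaceI[of "slice 0 g" "slice 1 g" "slice 2 g"])
      (use assms a(2-4) Syz_iff[OF assms(2)] vec_below_slice[OF assms(2)] in \<open>simp_all add: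
          vec_coeff_monom\<close>)
qed

text \<open>The multiplier of a leading coefficient is unique only up to the line spanned by \<open>f\<^sub>n\<close>.\<close>

lemma lead_surj:
  assumes "w \<in> lead_space (Suc e)"
  shows "\<exists>g. g \<in> Syz f \<and> graded_vec 2 e g \<and> w - lead e g \<in> lead_space 0"
proof -
  obtain a0 a1 where w: "w = pair_vec a0 a1" by (rule pair_vec_cases)
  obtain g0 g1 g2 where syz: "quadratic_syzygy p q g0 g1 g2"
    and bel: "vec_below (Suc e) g0" "vec_below (Suc e) g1" "vec_below (Suc e) g2"
    and lead: "vec_coeff (Suc e) (monom 1 1 *s g0) = cross a0 q\<^sub>n"
        "vec_coeff (Suc e) (monom 1 1 *s g1) = cross a0 p\<^sub>n + cross a1 q\<^sub>n"
        "vec_coeff (Suc e) (monom 1 1 *s g2) = cross a1 p\<^sub>n"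
    using assms unfolding w by (rule lead_spaceE)
  obtain g where g: "g \<in> Syz f" "graded_vec 2 e g" "slice 0 g = g0" "slice 1 g = g1"
      "slice 2 g = g2"
    using ex_syzygy[OF syz bel] by blast
  obtain b0 b1 where b: "lead e g = pair_vec b0 b1" "cross b0 q\<^sub>n = vec_coeff e (slice 0 g)"
    "cross b0 p\<^sub>n + cross b1 q\<^sub>n = vec_coeff e (slice 1 g)" "cross b1 p\<^sub>n = vec_coeff e (slice 2 g)"
    using lead_eq[OF g(1,2)] by blast
  have "pair_vec (a0 - b0) (a1 - b1) \<in> lead_space 0"
    by (rule lead_spaceI[of 0 0 0])
      (use lead b g in \<open>simp_all add: quadratic_syzygy_linear vec_coeff_monom cross_linear
          algebra_simps\<close>)
  then show ?thesis
    using g by (auto simp: w b(1) pair_vec_linear)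
qed

text \<open>If the leading coefficient of \<open>g\<close> already occurs in degree \<open>e - 1\<close>, for a syzygy \<open>h\<close>, then
\<open>g - u h\<close> loses its leading coefficient and is divisible by \<open>v\<close>.\<close>

lemma mem_m_Syz_of_lead:
  assumes g: "g \<in> Syz f" "graded_vec 2 e g" and "lead e g \<in> lead_space e"
  shows "g \<in> m_Syz f"
proof -
  obtain a0 a1 where a: "lead e g = pair_vec a0 a1" "cross a0 q\<^sub>n = vec_coeff e (slice 0 g)"
    "cross a0 p\<^sub>n + cross a1 q\<^sub>n = vec_coeff e (slice 1 g)" "cross a1 p\<^sub>n = vec_coeff e (slice 2 g)"
    using lead_eq[OF g] by blast
  obtain h0 h1 h2 where syz: "quadratic_syzygy p q h0 h1 h2"
    and bel: "vec_below e h0" "vec_below e h1" "vec_below e h2"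
    and lead': "vec_coeff e (monom 1 1 *s h0) = cross a0 q\<^sub>n"
        "vec_coeff e (monom 1 1 *s h1) = cross a0 p\<^sub>n + cross a1 q\<^sub>n"
        "vec_coeff e (monom 1 1 *s h2) = cross a1 p\<^sub>n"
    using assms(3) unfolding a(1) by (rule lead_spaceE)
  note lead = trans[OF lead'(1) a(2)] trans[OF lead'(2) a(3)] trans[OF lead'(3) a(4)]
  show ?thesis
  proof (cases e)
    case 0
    have "vec_below 0 (slice j g)" if "vec_coeff 0 (slice j g) = 0" for j
      using vec_below_slice[OF g(2), of j] that by (intro vec_below_drop[of 0]) (simp_all add: 0)
    then have "slice 0 g = 0" "slice 1 g = 0" "slice 2 g = 0"
      using lead by (simp_all add: 0 vec_coeff_monom)
    then have "g = 0"
      by (intro graded_vec_eqI[OF g(2)]) simp_all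
    then show ?thesis using free_module.subspace_0[OF subspace_m_Syz] by simp
  next
    case (Suc d)
    obtain h where h: "h \<in> Syz f" "graded_vec 2 d h" "slice 0 h = h0" "slice 1 h = h1"
        "slice 2 h = h2"
      using ex_syzygy[OF syz bel[unfolded Suc]] by blast
    have g': "graded_vec 2 (Suc d) g" using g(2) Suc by simp
    have uh: "Var Var_u *s h \<in> Syz f" "graded_vec 2 (Suc d) (Var Var_u *s h)"
      by (rule Syz_smult[OF h(1)], rule graded_vec_Var(3)[OF h(2)])
    have "vec_coeff (Suc d) (slice 0 (g - Var Var_u *s h)) = 0"
      "vec_coeff (Suc d) (slice 1 (g - Var Var_u *s h)) = 0"
      "vec_coeff (Suc d) (slice 2 (g - Var Var_u *s h)) = 0"
      using lead by (simp_all only: slice_linear slice_Var_u vec_coeff_linear h Suc) simp_all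
    then obtain k where k: "k \<in> Syz f" "g - Var Var_u *s h = Var Var_v *s k"
      by (rule divide_v[OF Syz_diff[OF g(1) uh(1)] graded_vec_diff[OF g' uh(2)]])
    have "g = Var Var_u *s h + Var Var_v *s k" using k(2) by (simp add: algebra_simps)
    then show ?thesis
      by (simp only:) (intro free_module.subspace_add[OF subspace_m_Syz] Var_smult_in_m_Syz h(1)
          k(1))
  qed
qed

lemma Syz_linear_eq_0:
  assumes "a \<in> Syz f" "graded_vec 1 e a" "e < n"
  shows "a = 0"
proof (rule graded_vec_1_eq_0[OF assms(2)])
  have "vec_below n (slice j a)" for j
    using vec_below_mono[OF vec_below_slice[OF assms(2)]] assms(3) by simp
  then have "slice 1 a = 0 \<and> slice 0 a = 0"
    using linear_syzygy_eq_0 Syz_1_dest[OF graded assms(2,1)] by blast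
  then show "slice 0 a = 0" "slice 1 a = 0" by blast+
qed

text \<open>In \<open>g = s a + t b + u c + v d\<close> the linear syzygies \<open>a\<close> and \<open>b\<close> have \<open>x\<close>-degree less than
\<open>n\<close> and vanish, and multiplication by \<open>v\<close> does not reach the leading coefficient; so this
coefficient is that of \<open>c\<close>.\<close>

lemma lead_of_mem_m_Syz:
  assumes g: "g \<in> m_Syz f" "graded_vec 2 e g" and "e < n"
  shows "lead e g \<in> lead_space e"
proof -
  have fg: "f $ i \<in> graded_part (int 1, int n)" for i using graded by blast
  obtain a b c d where *: "a \<in> Syz f" "b \<in> Syz f" "c \<in> Syz f" "d \<in> Syz f"
    "\<And>i. a $ i \<in> graded_part (int 2 - 1, int e)" "\<And>i. b $ i \<in> graded_part (int 2 - 1, int e)"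
    "\<And>i. c $ i \<in> graded_part (int 2, int e - 1)" "\<And>i. d $ i \<in> graded_part (int 2, int e - 1)"
    "g = Var Var_s *s a + Var Var_t *s b + Var Var_u *s c + Var Var_v *s d"
    using m_Syz_gradedE[OF fg g(1), of "int 2" "int e"] g(2) by blast
  have "a = 0" "b = 0"
    using * Syz_linear_eq_0[of _ e] assms(3) by simp_all
  then have gcd: "g = Var Var_u *s c + Var Var_v *s d" using *(9) by simp
  show ?thesis
  proof (cases e)
    case 0
    have "x = 0" if "x \<in> graded_part (2, - 1)" for x :: "'k bipoly"
      using that by (intro poly_mapping_eqI) (force simp: graded_part_altdef bideg_def)
    then have "c = 0" "d = 0" using *(7,8) 0 by (simp_all add: vec_eq_iff)
    then have "lead e g = 0" by (simp add: gcd lead_def pair_vec_zero)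
    then show ?thesis using vec.subspace_0[OF subspace_lead_space] by simp
  next
    case (Suc k)
    then have cd: "graded_vec 2 k c" "graded_vec 2 k d" using *(7,8) by simp_all
    have gS: "g \<in> Syz f" unfolding *(9) by (intro Syz_add Syz_smult *(1-4))
    obtain a0 a1 where a: "lead e g = pair_vec a0 a1" "cross a0 q\<^sub>n = vec_coeff e (slice 0 g)"
      "cross a0 p\<^sub>n + cross a1 q\<^sub>n = vec_coeff e (slice 1 g)"
          "cross a1 p\<^sub>n = vec_coeff e (slice 2 g)"
      using lead_eq[OF gS g(2)] by blast
    have "vec_coeff e (slice j g) = vec_coeff e (monom 1 1 *s slice j c)" for j
      using vec_below_slice[OF cd(2), of j] by (simp add: gcd vec_below_def Suc)
    then show ?thesis
      unfolding a(1) using a(2-4) cd(1) *(3) Suc Syz_iff[OF cd(1)] vec_below_slice[OF cd(1)]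
      by (intro lead_spaceI[of "slice 0 c" "slice 1 c" "slice 2 c"]) simp_all
  qed
qed

end

definition const_vec :: "'k::field ^ 3 \<Rightarrow> 'k bipoly ^ 3" where
  "const_vec a = (\<chi> i. Const (a $ i))"

lemma graded_vec_cross_const:
  assumes "graded_vec 1 n f"
  shows "graded_vec 1 n (cross (const_vec a) f)"
proof -
  have "Const c * f $ i \<in> graded_part ((0, 0) + (int 1, int n))" for c i
    using assms by (intro graded_part_mult Const_graded) blast
  then have "Const c * f $ i \<in> graded_part (int 1, int n)" for c i by simp
  then show ?thesis
    unfolding forall_3 cross_def const_vec_def vector_3 vec_lambda_beta
    by (intro conjI graded_part_diff)
qed

lemma vec_coeff_slice_cross_const:
  "vec_coeff k (slice j (cross (const_vec a) f)) = cross a (vec_coeff k (slice j f))"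
  by (simp add: vec3_eq_iff cross_def const_vec_def)

lemma vec_coeff_slice_scale_vec:
  "vec_coeff e (slice j (scale_vec c g)) = c *s vec_coeff e (slice j g)"
  by (simp add: scale_vec_def)

lemma free_subspace_imp: "free_module.subspace S \<Longrightarrow> vec_space.subspace S"
  unfolding free_module.subspace_def vec_space.subspace_def scale_vec_def by blast

lemma subspace_Syz_part:
  fixes f :: "'k::field bipoly ^ 3"
  shows "vec_space.subspace (Syz_part n f a)"
proof (rule vec_space.subspaceI)
  show "0 \<in> Syz_part n f a"
    using free_module.subspace_0[OF subspace_Syz] by (simp add: Syz_part_def)
next
  fix x y assume "x \<in> Syz_part n f a" "y \<in> Syz_part n f a"
  then show "x + y \<in> Syz_part n f a"
    by (simp add: Syz_part_def Syz_add graded_part_add)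
next
  fix c :: 'k and x assume x: "x \<in> Syz_part n f a"
  have "Const c * p \<in> graded_part d" if "p \<in> graded_part d" for p :: "'k bipoly" and d
    using graded_part_mult[OF Const_graded that, of c] by (simp add: zero_prod_def[symmetric])
  with x show "scale_vec c x \<in> Syz_part n f a"
    by (simp add: Syz_part_def scale_vec_def Syz_smult)
qed

context bihom_pencil
begin

lemma linear_lead: "Vector_Spaces.linear scale_vec ((*s) :: 'k \<Rightarrow> 'k ^ (3 + 3) \<Rightarrow> 'k ^ (3 +
    3)) (lead e)"
proof -
  have "lead e (g + h) = lead e g + lead e h" for g h
    by (simp add: lead_def pair_vec_linear cross_linear dot_linear vector_sadd_rdistrib)
  moreover have "lead e (scale_vec c g) = c *s lead e g" for c g
    by (simp add: lead_def vec_coeff_slice_scale_vec pair_vec_linear cross_linear dot_linear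
      vec.scale_right_diff_distrib vector_smult_assoc)
  ultimately show ?thesis
    unfolding Vector_Spaces.linear_iff
    using vec_space.vector_space_axioms vec.vector_space_axioms by blast
qed

lemma betti1_below:
  assumes "e < n"
  shows "betti1 n f (3, int (n + e)) = vec.dim (lead_space (Suc e)) - vec.dim (lead_space e)"
  unfolding betti1_def
proof (rule vec_space.quotient_dim_image[OF linear_lead[of e]])
  show "vec_space.subspace (m_Syz f)"
    by (rule free_subspace_imp[OF subspace_m_Syz])
  show "vec_space.subspace (Syz_part n f (3, int (n + e)))"
    by (rule subspace_Syz_part)
  show "\<exists>x\<in>Syz_part n f (3, int (n + e)). w - lead e x \<in> lead_space e"
    if w: "w \<in> lead_space (Suc e)" for w
    using lead_surj[OF w] lead_space_mono[of 0 e] unfolding Bex_def Syz_part_iff by blast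
  show "x \<in> m_Syz f \<longleftrightarrow> lead e x \<in> lead_space e" if "x \<in> Syz_part n f (3, int (n + e))" for x
    using that mem_m_Syz_of_lead[of x e] lead_of_mem_m_Syz[of x e] assms unfolding Syz_part_iff
        by blast
  show "lead e x \<in> lead_space (Suc e)" if "x \<in> Syz_part n f (3, int (n + e))" for x
    using that lead_mem_lead_space_Suc[of x e] unfolding Syz_part_iff by blast
qed (simp_all only: subspace_lead_space lead_space_Suc)

text \<open>From degree \<open>n\<close> on, the leading coefficient \<open>a \<times> f\<^sub>n\<close> is attained by \<open>u ^ (e - n) (a \<times> f)\<close>
with constant \<open>a0\<close> and \<open>a1\<close>, which lies in \<open>m Syz\<close> because of the factors \<open>t\<close> and \<open>s\<close> of its two
parts.\<close>

lemma mem_m_Syz_above: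
  assumes g: "g \<in> Syz f" "graded_vec 2 e g" and "n \<le> e"
  shows "g \<in> m_Syz f"
proof -
  obtain a0 a1 where a: "cross a0 q\<^sub>n = vec_coeff e (slice 0 g)"
    "cross a0 p\<^sub>n + cross a1 q\<^sub>n = vec_coeff e (slice 1 g)" "cross a1 p\<^sub>n = vec_coeff e (slice 2 g)"
    using lead_eq[OF g] by blast
  obtain d where e: "e = Suc d" using \<open>n \<le> e\<close> n by (cases e) auto
  define k0 k1 where "k0 = Var Var_u ^ (e - n) *s cross (const_vec a0) f"
    and "k1 = Var Var_u ^ (e - n) *s cross (const_vec a1) f"
  define k where "k = Var Var_t *s k0 + Var Var_s *s k1"
  have kS: "k0 \<in> Syz f" "k1 \<in> Syz f"
    unfolding k0_def k1_def by (intro Syz_smult koszul_in_Syz)+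
  have deg: "graded_vec 1 e k0" "graded_vec 1 e k1"
    unfolding k0_def k1_def
    using graded_vec_Var_u_power[OF graded_vec_cross_const[OF graded], of "e - n"] \<open>n \<le> e\<close>
        by simp_all
  have kdeg: "graded_vec 2 e k"
    unfolding k_def numeral_2_eq_2
    by (intro graded_vec_add graded_vec_Var deg[unfolded One_nat_def])
  have coeff_k: "vec_coeff e (slice j k0) = cross a0 (vec_coeff n (slice j f))"
    "vec_coeff e (slice j k1) = cross a1 (vec_coeff n (slice j f))" for j
    using \<open>n \<le> e\<close>
        by (simp_all add: k0_def k1_def slice_Var_u_power vec_coeff_monom
          vec_coeff_slice_cross_const)
  have "slice 2 k0 = 0"
    using coeff_dehom_eq_0[OF deg(1), of 2] by (simp add: vec_eq_iff poly_eq_iff)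
  then have "vec_coeff e (slice 0 k) = cross a0 q\<^sub>n"
      "vec_coeff e (slice 1 k) = cross a0 p\<^sub>n + cross a1 q\<^sub>n"
    "vec_coeff e (slice 2 k) = cross a1 p\<^sub>n"
    by (simp_all add: k_def coeff_k numeral_2_eq_2)
  then have "vec_coeff (Suc d) (slice 0 (g - k)) = 0" "vec_coeff (Suc d) (slice 1 (g - k)) = 0"
    "vec_coeff (Suc d) (slice 2 (g - k)) = 0"
    using a by (simp_all only: slice_linear vec_coeff_linear e diff_self)
  moreover have "g - k \<in> Syz f"
    unfolding k_def by (intro Syz_diff Syz_add Syz_smult g kS)
  moreover have "graded_vec 2 (Suc d) (g - k)"
    using graded_vec_diff[OF g(2) kdeg] e by simp
  ultimately obtain h where h: "h \<in> Syz f" "g - k = Var Var_v *s h"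
    using divide_v by metis
  have "g = Var Var_t *s k0 + Var Var_s *s k1 + Var Var_v *s h"
    using h(2) by (simp add: k_def algebra_simps)
  then show ?thesis
    by (simp only:) (intro free_module.subspace_add[OF subspace_m_Syz] Var_smult_in_m_Syz kS h(1))
qed

text \<open>For \<open>m \<ge> 2 n\<close> the preceding lemma applies, and for \<open>m < n\<close> the entries have negative degree
in \<open>u\<close>, \<open>v\<close>.\<close>

lemma betti1_above:
  assumes "m \<notin> (\<lambda>e. int (n + e)) ` {..<n}"
  shows "betti1 n f (3, m) = 0"
proof -
  have "g \<in> m_Syz f" if g: "g \<in> Syz_part n f (3, m)" for g
  proof (cases "m \<ge> int n")
    case True
    define e where "e = nat (m - int n)"
    have m: "m = int (n + e)" using True by (simp add: e_def)
    then have "n \<le> e" using assms by force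
    then show ?thesis
      using g unfolding m Syz_part_iff by (intro mem_m_Syz_above) simp_all
  next
    case False
    have "g $ i = 0" for i
    proof (rule poly_mapping_eqI, rule ccontr)
      fix x assume "Poly_Mapping.lookup (g $ i) x \<noteq> Poly_Mapping.lookup 0 x"
      then have "bideg x = (2, m - int n)"
        using g by (simp add: Syz_part_def graded_part_altdef)
      then show False using False by (simp add: bideg_def)
    qed
    then have "g = 0" by (simp add: vec_eq_iff)
    then show ?thesis using free_module.subspace_0[OF subspace_m_Syz] by simp
  qed
  then show ?thesis
    unfolding betti1_def
    by (intro vec_space.quotient_dim_eq_0 free_subspace_imp[OF subspace_m_Syz]) blast
qed

text \<open>The differences of dimensions telescope, and \<open>lead_space 0\<close> is a line.\<close>

theorem betti1_3_eq: "betti1_3 n f = vec.dim (vec.span (f_coeff ` {..n})) - 1"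
proof -
  have "m \<in> (\<lambda>e. int (n + e)) ` {..<n}" if "betti1 n f (3, m) \<noteq> 0" for m
    by (rule ccontr) (rule notE[OF that betti1_above])
  then have "betti1_3 n f = (\<Sum>m\<in>(\<lambda>e. int (n + e)) ` {..<n}. betti1 n f (3, m))"
    unfolding betti1_3_def
        by (intro Sum_any.expand_superset) (simp, rule subsetI, simp only: mem_Collect_eq)
  also have "\<dots> = (\<Sum>e<n. vec.dim (lead_space (Suc e)) - vec.dim (lead_space e))"
    by (subst sum.reindex) (auto simp: inj_on_def betti1_below simp del: of_nat_add)
  also have "(\<Sum>e<m. vec.dim (lead_space (Suc e)) - vec.dim (lead_space e)) =
      vec.dim (lead_space m) - vec.dim (lead_space 0)" for m
  proof (induction m)
    case (Suc m)
    have "vec.dim (lead_space 0) \<le> vec.dim (lead_space m)"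
      "vec.dim (lead_space m) \<le> vec.dim (lead_space (Suc m))"
      by (intro vec.dim_subset lead_space_mono; simp)+
    then show ?case using Suc by simp
  qed simp
  finally show ?thesis by (simp only: dim_lead_space_0 lead_space_eq)
qed

corollary betti1_3_bounds: "betti1_3 n f \<in> {1, 2, 3, 4, 5}"
proof -
  have "1 \<le> betti1_3 n f" "betti1_3 n f \<le> 5"
    using dim_lead_space_le[of n] dim_lead_space_ge
    unfolding betti1_3_eq lead_space_eq by linarith+
  then show ?thesis by auto
qed

end

section \<open>Base points\<close>

text \<open>In every term of the binomial expansion one of the two exponents is large enough.\<close>

lemma power_add_mem_ideal:
  fixes J :: "'a::comm_ring_1 set"
  assumes J: "0 \<in> J" "\<And>a b. a \<in> J \<Longrightarrow> b \<in> J \<Longrightarrow> a + b \<in> J" "\<And>r a. a \<in> J \<Longrightarrow> r * a \<in> J"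
    and "a ^ m \<in> J" "b ^ k \<in> J"
  shows "(a + b) ^ (m + k) \<in> J"
proof -
  have sum: "sum g A \<in> J" if "\<And>i. i \<in> A \<Longrightarrow> g i \<in> J" for g and A :: "nat set"
    using that by (induction A rule: infinite_finite_induct) (auto intro: J)
  have "of_nat (m + k choose i) * a ^ i * b ^ (m + k - i) \<in> J" for i
  proof (cases "i \<ge> m")
    case True
    then have "a ^ i = a ^ (i - m) * a ^ m" by (simp flip: power_add)
    then have "of_nat (m + k choose i) * a ^ i * b ^ (m + k - i) =
        (of_nat (m + k choose i) * b ^ (m + k - i) * a ^ (i - m)) * a ^ m"
      by (simp only: mult_ac)
    then show ?thesis using J(3) assms(4) by simp
  next
    case False
    then have "b ^ (m + k - i) = b ^ (m - i) * b ^ k" by (simp flip: power_add)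
    then have "of_nat (m + k choose i) * a ^ i * b ^ (m + k - i) =
        (of_nat (m + k choose i) * a ^ i * b ^ (m - i)) * b ^ k"
      by (simp only: mult_ac)
    then show ?thesis using J(3) assms(5) by simp
  qed
  then show ?thesis
    unfolding binomial_ring by (intro sum)
qed

lemma mem_I_W: "x \<in> I_W f \<longleftrightarrow> (\<exists>a. x = dot a f)"
proof
  assume "x \<in> I_W f"
  moreover have "range (($) f) = {f $ 1, f $ 2, f $ 3}"
    unfolding UNIV_3 by blast
  ultimately obtain k1 k2 k3 where "x - k1 * f $ 1 - k2 * f $ 2 - k3 * f $ 3 = 0"
    unfolding I_W_def ideal_gen_def by (auto simp: ring_module.span_breakdown_eq)
  then have "x = dot (vector [k1, k2, k3]) f"
    by (simp add: dot_def sum_3 vector_3 algebra_simps)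
  then show "\<exists>a. x = dot a f" by blast
next
  assume "\<exists>a. x = dot a f"
  then show "x \<in> I_W f"
    unfolding I_W_def ideal_gen_def dot_def
    by (elim exE, simp only:) (intro ring_module.span_sum ring_module.span_scale
        ring_module.span_base rangeI)
qed

lemma mem_ideal_gen_2: "x \<in> ideal_gen {a, b} \<longleftrightarrow> (\<exists>k l. x = k * a + l * b)"
proof -
  have "x - k * a - l * b = 0 \<longleftrightarrow> x = k * a + l * b" for k l
    by (auto simp: algebra_simps)
  then show ?thesis
    unfolding ideal_gen_def ring_module.span_breakdown_eq by simp
qed

lemma (in scalar_hom) eval_graded_1:
  fixes u v :: 'r
  assumes "graded_vec 1 n f"
  defines "B \<equiv> \<lambda>r. \<Sum>k\<le>n. \<kappa> (coeff r k) * (u ^ k * v ^ (n - k))"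
  shows "ev s t u v (f $ i) = s * B (slice 1 f $ i) + t * B (slice 0 f $ i)"
proof -
  have "f $ i = homogenise 1 n (dehom (f $ i))"
  proof (rule dehom_eqD)
    show "dehom (f $ i) = dehom (homogenise 1 n (dehom (f $ i)))"
      by (intro dehom_homogenise[symmetric]) (use coeff_dehom_eq_0[OF assms(1)] in \<open>metis not_le\<close>)
  qed (use assms homogenise_graded in blast)+
  then have "ev s t u v (f $ i) = ev s t u v (homogenise 1 n (dehom (f $ i)))" by simp
  also have "\<dots> = s * B (slice 1 f $ i) + t * B (slice 0 f $ i)"
    by (simp add: homogenise_def eval_sum B_def sum_distrib_left mult_ac)
  finally show ?thesis .
qed

lemma (in scalar_hom) eval_dot:
    "ev s t u v (dot a b) = dot (\<chi> i. ev s t u v (a $ i)) (\<chi> i. ev s t u v (b $ i))"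
  by (simp add: dot_def eval_sum)

lemma Var_mult_mem_radical:
  assumes "basepoint_free f" "x \<in> {Var_s, Var_t}" "z \<in> {Var_u, Var_v}"
  obtains k a where "(Var x * Var z) ^ k = dot a f"
proof -
  have "Var x * Var z \<in> ideal_gen {Var Var_s, Var Var_t}"
    unfolding mult.commute[of "Var x"] ideal_gen_def
    by (intro ring_module.span_scale ring_module.span_base) (use assms(2) in auto)
  moreover have "Var x * Var z \<in> ideal_gen {Var Var_u, Var Var_v}"
    unfolding ideal_gen_def
    by (intro ring_module.span_scale ring_module.span_base) (use assms(3) in auto)
  ultimately have "Var x * Var z \<in> radical (I_W f)"
    using assms(1) by (auto simp: basepoint_free_def)
  then show ?thesis using that by (auto simp: radical_def mem_I_W)
qed

text \<open>Let \<open>P\<close> and \<open>Q\<close> be the values of \<open>p\<close> and \<open>q\<close> at \<open>(u, v)\<close>, which are \<open>B 1\<close> and \<open>B 0\<close> below,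
and \<open>J\<close> the ideal of the minors of \<open>P\<close> and \<open>Q\<close>. Substituting \<open>s = Q\<^sub>i\<close>, \<open>t = - P\<^sub>i\<close> turns every
\<open>f\<^sub>j\<close> into a minor; as a power of \<open>t u\<close> or \<open>t v\<close> lies in the ideal of the net, a power of every
\<open>P\<^sub>i\<close> lies in \<open>J\<close>. Substituting \<open>s = 1\<close>, \<open>t = 0\<close> shows that the \<open>P\<^sub>i\<close> generate the unit ideal.
Therefore \<open>J\<close> is the unit ideal.\<close>

lemma (in scalar_hom) unimodular_minors:
  fixes u v :: 'r
  assumes f: "graded_vec 1 n f" and bpf: "basepoint_free f" and uv: "u = 1 \<or> v = 1"
  defines "B \<equiv> \<lambda>j. \<chi> i. \<Sum>k\<le>n. \<kappa> (coeff (slice j f $ i) k) * (u ^ k * v ^ (n - k))"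
  shows "\<exists>y. dot y (cross (B 1) (B 0)) = 1"
proof -
  let ?c = "cross (B 1) (B 0)"
  define J where "J = range (\<lambda>y. dot y ?c)"
  have J0: "0 \<in> J" unfolding J_def by (rule range_eqI[of _ _ 0]) simp
  have Jadd: "a + b \<in> J" if "a \<in> J" "b \<in> J" for a b
    using that unfolding J_def by (auto simp flip: dot_linear)
  have Jmult: "r * a \<in> J" if "a \<in> J" for r a
    using that unfolding J_def by (auto simp flip: dot_linear)
  obtain z where z: "z \<in> {Var_u, Var_v}" "ev s t u v (Var z) = 1" for s t
    using uv by (metis eval_Var(3,4) insertCI)
  have ev_f: "(\<chi> i. ev s t u v (f $ i)) = s *s B 1 + t *s B 0" for s t
    using eval_graded_1[OF f] by (simp add: vec_eq_iff B_def)
  obtain k a where ka: "(Var Var_s * Var z) ^ k = dot a f"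
    using Var_mult_mem_radical[OF bpf _ z(1), of Var_s] by blast
  obtain l b where lb: "(Var Var_t * Var z) ^ l = dot b f"
    using Var_mult_mem_radical[OF bpf _ z(1), of Var_t] by blast
  define a' where "a' = (\<chi> i. ev 1 0 u v (a $ i))"
  have "1 = ev 1 0 u v ((Var Var_s * Var z) ^ k)" by (simp add: z)
  also have "\<dots> = dot a' (B 1)" by (simp add: ka eval_dot ev_f a'_def)
  finally have one: "1 = dot a' (B 1)" .
  have B_power: "(B 1 $ i) ^ l \<in> J" for i
  proof -
    define b' where "b' = (\<chi> j. ev (B 0 $ i) (- B 1 $ i) u v (b $ j))"
    have e: "dot d (axis i 1) = d $ i" for d :: "'b::comm_ring_1 ^ 3"
      using exhaust_3[of i] by (auto simp: dot_def sum_3 axis_def)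
    have "(- B 1 $ i) ^ l = ev (B 0 $ i) (- B 1 $ i) u v ((Var Var_t * Var z) ^ l)" by (simp add: z)
    also have "\<dots> = dot b' (B 0 $ i *s B 1 + (- B 1 $ i) *s B 0)"
      by (simp add: lb eval_dot ev_f b'_def)
    \<comment> \<open>The values of the \<open>f\<^sub>j\<close> form a row of the skew-symmetric matrix of minors.\<close>
    also have "B 0 $ i *s B 1 + (- B 1 $ i) *s B 0 = cross (axis i 1) ?c"
      using cross_cross[of "B 1" "B 0" "axis i 1"] by (simp add: e cross_swap[of
          "axis i 1"] smult_neg)
    also have "dot b' (cross (axis i 1) ?c) = dot (cross b' (axis i 1)) ?c"
      by (simp add: dot_cross_rotate)
    finally have "(- B 1 $ i) ^ l \<in> J" unfolding J_def by simp
    then have "(- 1) ^ l * (- B 1 $ i) ^ l \<in> J" by (rule Jmult)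
    then show ?thesis by (simp flip: power_mult_distrib)
  qed
  have "(a' $ i * B 1 $ i) ^ l \<in> J" for i
    unfolding power_mult_distrib by (rule Jmult[OF B_power])
  then have "(a' $ 1 * B 1 $ 1 + a' $ 2 * B 1 $ 2 + a' $ 3 * B 1 $ 3) ^ (l + l + l) \<in> J"
    by (intro power_add_mem_ideal J0 Jadd Jmult)
  then have "1 \<in> J" using one by (simp add: dot_def sum_3)
  then show ?thesis unfolding J_def by (metis imageE)
qed

text \<open>The affine chart is \<open>u = x\<close>, \<open>v = 1\<close> with values in the polynomials, and the point at
infinity is \<open>u = 1\<close>, \<open>v = 0\<close> with values in the field.\<close>

lemma bihom_pencil_of_basepoint_free:
  fixes f :: "'k::field bipoly ^ 3"
  assumes "n > 0" and f: "graded_vec 1 n f" and bpf: "basepoint_free f"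
  obtains y y' where "bihom_pencil n f y y'"
proof -
  interpret x: scalar_hom "\<lambda>c :: 'k. [:c:]" by unfold_locales (simp_all add: one_pCons)
  interpret i: scalar_hom "\<lambda>c :: 'k. c" by unfold_locales simp_all
  have below: "vec_below (Suc n) (slice j f)" for j
    by (rule vec_below_slice[OF f])
  have "(\<Sum>k\<le>n. [:coeff r k:] * ([:0, 1:] ^ k * 1 ^ (n - k))) = r" if "\<forall>k>n. coeff r k = 0"
      for r :: "'k poly"
    using poly_as_sum_of_monoms'[of r n] that by (simp add: degree_le monom_altdef)
  then have "(\<chi> i. \<Sum>k\<le>n. [:coeff (slice j f $ i) k:] * ([:0, 1:] ^ k * 1 ^ (n - k))) = slice j f"
      for j
    using vec_belowD[OF below] by (simp only: vec_eq_iff vec_lambda_beta Suc_le_eq) blast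
  then obtain y where y: "dot y (cross (slice 1 f) (slice 0 f)) = 1"
    using x.unimodular_minors[OF f bpf, of "[:0, 1:]" 1] by (simp only: simp_thms) blast
  have "(\<Sum>k\<le>n. coeff r k * (1 ^ k * 0 ^ (n - k))) = coeff r n" for r :: "'k poly"
    by (subst sum.remove[of _ n]) (auto intro!: sum.neutral)
  then have "(\<chi> i. \<Sum>k\<le>n. coeff (slice j f $ i) k * (1 ^ k * 0 ^ (n - k))) =
      vec_coeff n (slice j f)" for j
    by (simp add: vec_eq_iff)
  then obtain y' where y': "dot y' (cross (vec_coeff n (slice 1 f)) (vec_coeff n (slice 0 f))) = 1"
    using i.unimodular_minors[OF f bpf, of 1 0] by (simp only: simp_thms) blast
  have "bihom_pencil n f y y'"
    by unfold_locales (use assms(1) f below y y' in blast)+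
  then show ?thesis by (rule that)
qed

section \<open>Nets attaining every value\<close>

lemma radical_add:
  assumes "x \<in> radical (I_W f)" "y \<in> radical (I_W f)"
  shows "x + y \<in> radical (I_W f)"
proof -
  obtain m k where "x ^ m \<in> I_W f" "y ^ k \<in> I_W f"
    using assms by (auto simp: radical_def)
  then have "(x + y) ^ (m + k) \<in> I_W f"
    unfolding I_W_def ideal_gen_def
    by (intro power_add_mem_ideal ring_module.span_zero ring_module.span_add ring_module.span_scale)
  then show ?thesis by (auto simp: radical_def)
qed

lemma radical_mult:
  assumes "x \<in> radical (I_W f)"
  shows "r * x \<in> radical (I_W f)"
proof -
  obtain m where "x ^ m \<in> I_W f" using assms by (auto simp: radical_def)
  then have "(r * x) ^ m \<in> I_W f"
    unfolding I_W_def ideal_gen_def power_mult_distrib by (rule ring_module.span_scale)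
  then show ?thesis by (auto simp: radical_def)
qed

lemma radical_power:
  assumes "x ^ m \<in> radical (I_W f)"
  shows "x \<in> radical (I_W f)"
  using assms by (auto simp: radical_def simp flip: power_mult)

lemma I_W_subset_radical: "x \<in> I_W f \<Longrightarrow> x \<in> radical (I_W f)"
  unfolding radical_def by (auto intro: exI[of _ 1])

lemma radical_mult_power:
  assumes "x * y ^ m \<in> radical (I_W f)" "m > 0"
  shows "x * y \<in> radical (I_W f)"
proof (rule radical_power)
  obtain k where m: "m = Suc k" using \<open>m > 0\<close> by (cases m) auto
  have "(x * y) ^ m = x ^ k * (x * y ^ m)"
    unfolding m power_mult_distrib power_Suc by (simp only: mult_ac)
  then show "(x * y) ^ m \<in> radical (I_W f)"
    by (simp only: radical_mult[OF assms(1)])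
qed

interpretation const_hom: scalar_hom "Const :: 'k::field \<Rightarrow> 'k bipoly"
  by unfold_locales (simp_all add: Const_simps)

lemma Const_Var_expand: "Poly_Mapping.single m c = Const c *
    (Var Var_s ^ Poly_Mapping.lookup m Var_s * Var Var_t ^ Poly_Mapping.lookup m Var_t *
     Var Var_u ^ Poly_Mapping.lookup m Var_u * Var Var_v ^ Poly_Mapping.lookup m Var_v)"
proof -
  have p: "Var x ^ k = Poly_Mapping.single (Poly_Mapping.single x k) 1" for x k
    by (induction k) (simp_all add: Var_def mult_single flip: single_add)
  have "monomial (Poly_Mapping.lookup m Var_s) (Poly_Mapping.lookup m Var_t)
    (Poly_Mapping.lookup m Var_u) (Poly_Mapping.lookup m Var_v) = m"
    by (rule monomial_lookup)
  then show ?thesis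
    by (simp add: p Const_def mult_single flip: monomial_def)
qed

lemma ideal_cong_mult:
  fixes A :: "'k::field bipoly set"
  assumes "x - x' \<in> ideal_gen A" "y - y' \<in> ideal_gen A"
  shows "x * y - x' * y' \<in> ideal_gen A"
proof -
  have "x * y - x' * y' = x * (y - y') + y' * (x - x')"
    by (simp add: algebra_simps)
  then show ?thesis
    using assms unfolding ideal_gen_def
    by (simp only:) (intro ring_module.span_add ring_module.span_scale)
qed

lemma ideal_cong_power:
  fixes A :: "'k::field bipoly set"
  assumes "x - x' \<in> ideal_gen A"
  shows "x ^ k - x' ^ k \<in> ideal_gen A"
proof (induction k)
  case 0
  show ?case by (simp add: ideal_gen_def ring_module.span_zero)
next
  case (Suc k)
  show ?case unfolding power_Suc by (rule ideal_cong_mult[OF assms Suc])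
qed

lemma eval_cong_ideal:
  fixes p :: "'k::field bipoly"
  assumes "Var Var_s - s \<in> ideal_gen A" "Var Var_t - t \<in> ideal_gen A"
    "Var Var_u - u \<in> ideal_gen A" "Var Var_v - v \<in> ideal_gen A"
  shows "p - eval_bipoly Const s t u v p \<in> ideal_gen A"
proof (induction p rule: bipoly_induct)
  case zero
  show ?case by (simp add: ideal_gen_def ring_module.span_zero)
next
  case (single m c)
  have "Const c - Const c \<in> ideal_gen A"
    by (simp add: ideal_gen_def ring_module.span_zero)
  then show ?case
    unfolding const_hom.eval_single
    by (subst Const_Var_expand) (intro ideal_cong_mult ideal_cong_power assms)
next
  case (add p q)
  have "p + q - eval_bipoly Const s t u v (p + q) =
      (p - eval_bipoly Const s t u v p) + (q - eval_bipoly Const s t u v q)"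
    by simp
  with add show ?case
    unfolding ideal_gen_def by (simp only: ring_module.span_add)
qed

text \<open>The quotient by each of these ideals is embedded in the ring by setting two variables to
\<open>0\<close>, and the ring is an integral domain.\<close>

lemma prime_ideals:
  fixes p :: "'k::field bipoly"
  assumes "k > 0"
  shows "p ^ k \<in> ideal_gen {Var Var_s, Var Var_t} \<Longrightarrow> p \<in> ideal_gen {Var Var_s, Var Var_t}"
    and "p ^ k \<in> ideal_gen {Var Var_u, Var Var_v} \<Longrightarrow> p \<in> ideal_gen {Var Var_u, Var Var_v}"
proof -
  assume "p ^ k \<in> ideal_gen {Var Var_s, Var Var_t}"
  then have "eval_bipoly Const 0 0 (Var Var_u) (Var Var_v) (p ^ k) = 0"
    by (auto simp: mem_ideal_gen_2 simp del: const_hom.eval_power)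
  then have "eval_bipoly Const 0 0 (Var Var_u) (Var Var_v) p = 0"
    by simp
  then show "p \<in> ideal_gen {Var Var_s, Var Var_t}"
    using eval_cong_ideal[of 0 "{Var Var_s, Var Var_t}" 0 "Var Var_u" "Var Var_v" p]
    by (simp add: ideal_gen_def ring_module.span_zero ring_module.span_base)
next
  assume "p ^ k \<in> ideal_gen {Var Var_u, Var Var_v}"
  then have "eval_bipoly Const (Var Var_s) (Var Var_t) 0 0 (p ^ k) = 0"
    by (auto simp: mem_ideal_gen_2 simp del: const_hom.eval_power)
  then have "eval_bipoly Const (Var Var_s) (Var Var_t) 0 0 p = 0"
    by simp
  then show "p \<in> ideal_gen {Var Var_u, Var Var_v}"
    using eval_cong_ideal[of "Var Var_s" "{Var Var_u, Var Var_v}" "Var Var_t" 0 0 p]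
    by (simp add: ideal_gen_def ring_module.span_zero ring_module.span_base)
qed

text \<open>An element of both ideals has its square in the ideal generated by \<open>s u\<close>, \<open>s v\<close>, \<open>t u\<close> and
\<open>t v\<close>.\<close>

lemma basepoint_freeI:
  fixes f :: "'k::field bipoly ^ 3"
  assumes sub: "\<And>i. f $ i \<in> ideal_gen {Var Var_s, Var Var_t} \<inter> ideal_gen {Var Var_u, Var Var_v}"
    and rad: "\<And>x z. x \<in> {Var_s, Var_t} \<Longrightarrow> z \<in> {Var_u, Var_v} \<Longrightarrow> Var x * Var z \<in> radical (I_W f)"
  shows "basepoint_free f"
  unfolding basepoint_free_def
proof (intro subset_antisym subsetI IntI)
  fix p assume "p \<in> radical (I_W f)"
  then obtain k where "p ^ k \<in> I_W f" by (auto simp: radical_def)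
  then have "p ^ Suc k \<in> I_W f"
    unfolding I_W_def ideal_gen_def power_Suc by (rule ring_module.span_scale)
  moreover have "I_W f \<subseteq> ideal_gen {Var Var_s, Var Var_t}"
      "I_W f \<subseteq> ideal_gen {Var Var_u, Var Var_v}"
    using sub unfolding I_W_def ideal_gen_def
    by (intro ring_module.span_minimal ring_module.subspace_span; blast)+
  ultimately show "p \<in> ideal_gen {Var Var_s, Var Var_t}" "p \<in> ideal_gen {Var Var_u, Var Var_v}"
    using prime_ideals[of "Suc k" p] by auto
next
  fix p :: "'k bipoly"
  assume "p \<in> ideal_gen {Var Var_s, Var Var_t} \<inter> ideal_gen {Var Var_u, Var Var_v}"
  then obtain a b c d where p: "p = a * Var Var_s + b * Var Var_t"
      "p = c * Var Var_u + d * Var Var_v"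
    unfolding Int_iff mem_ideal_gen_2 by blast
  have "p ^ 2 = (a * Var Var_s + b * Var Var_t) * (c * Var Var_u + d * Var Var_v)"
    unfolding power2_eq_square by (subst (1) p(1), subst (1) p(2)) (rule refl)
  also have "\<dots> = (a * c) * (Var Var_s * Var Var_u) + (a * d) * (Var Var_s * Var Var_v) +
      (b * c) * (Var Var_t * Var Var_u) + (b * d) * (Var Var_t * Var Var_v)"
    by (simp only: distrib_left distrib_right ac_simps)
  also have "\<dots> \<in> radical (I_W f)"
    by (intro radical_add radical_mult rad) auto
  finally show "p \<in> radical (I_W f)" by (rule radical_power)
qed

text \<open>The dehomogenised net has \<open>p = (x\<^sup>n + c, 1, x)\<close> and \<open>q = (d, x ^ (n - 1), x\<^sup>n + 1)\<close>. The
last two columns are chosen to have the constant minor \<open>1\<close>, and the first and the last to have a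
minor of leading term \<open>x ^ (2 n)\<close>; so there are no base points, whatever \<open>c\<close> and \<open>d\<close> of degree
less than \<open>n\<close> are.\<close>

definition example_net :: "nat \<Rightarrow> 'k::field bipoly \<Rightarrow> 'k bipoly \<Rightarrow> 'k bipoly ^ 3" where
  "example_net n c d = vector
    [Var Var_s * (Var Var_u ^ n + Var Var_v * c) + Var Var_t * (Var Var_v * d),
     Var Var_s * Var Var_v ^ n + Var Var_t * (Var Var_u ^ (n - 1) * Var Var_v),
     Var Var_s * (Var Var_u * Var Var_v ^ (n - 1)) + Var Var_t * (Var Var_u ^ n + Var Var_v ^ n)]"

text \<open>The last four identities express \<open>S\<close> and \<open>T\<close> times two of the minors by the generators. The
minor of the last two columns is \<open>V ^ (2 n)\<close>, and that of the first and the last is \<open>U ^ (2 n) + e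
V\<close>.\<close>

lemma example_net_identities:
  fixes S T U V c d :: "'a::comm_ring_1"
  assumes n: "n = Suc k" and f1: "f1 = S * (U ^ n + V * c) + T * (V * d)"
    and f2: "f2 = S * V ^ n + T * (U ^ k * V)" and f3: "f3 = S * (U * V ^ k) + T * (U ^ n + V ^ n)"
    and e: "e = c * (U ^ n + V ^ n) + U ^ n * V ^ k - U * V ^ k * d"
  shows "f1 = (S * U ^ k) * U + (S * c + T * d) * V" "f2 = 0 * U + (S * V ^ k + T * U ^ k) * V"
    "f3 = (S * V ^ k + T * U ^ k) * U + (T * V ^ k) * V"
    "S * V ^ (n + n) = (U ^ n + V ^ n) * f2 - (U ^ k * V) * f3"
    "T * V ^ (n + n) = V ^ n * f3 - (U * V ^ k) * f2"
    "S * U ^ (n + n) = ((U ^ n + V ^ n) * f1 - (V * d) * f3) + (- e) * (S * V)"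
    "T * U ^ (n + n) = ((U ^ n + V * c) * f3 - (U * V ^ k) * f1) + (- e) * (T * V)"
  by (simp_all add: f1 f2 f3 n e power_add algebra_simps)

text \<open>From the power of \<open>v\<close> that is a minor, \<open>s v\<close> and \<open>t v\<close> lie in the radical; modulo these the
other minor is a power of \<open>u\<close>.\<close>

lemma basepoint_free_example_net:
  fixes c d :: "'k::field bipoly"
  assumes "n > 0"
  shows "basepoint_free (example_net n c d)"
proof (rule basepoint_freeI)
  obtain k where n: "n = Suc k" using \<open>n > 0\<close> by (cases n) auto
  define S T U V :: "'k bipoly" where "S = Var Var_s" and "T = Var Var_t" and "U = Var Var_u" and
      "V = Var Var_v"
  note vars = S_def[symmetric] T_def[symmetric] U_def[symmetric] V_def[symmetric]
  define f where "f = example_net n c d"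
  have f: "f $ 1 = S * (U ^ n + V * c) + T * (V * d)" "f $ 2 = S * V ^ n + T * (U ^ k * V)"
    "f $ 3 = S * (U * V ^ k) + T * (U ^ n + V ^ n)"
    by (simp_all add: f_def example_net_def vector_3 n S_def T_def U_def V_def)
  have "S * a + T * b \<in> ideal_gen {S, T}" for a b
    unfolding mem_ideal_gen_2 by (intro exI[of _ a] exI[of _ b]) (simp only: mult.commute)
  then have st: "f $ i \<in> ideal_gen {S, T}" for i
    using exhaust_3[of i] by (elim disjE) (simp_all only: f)
  define e where "e = c * (U ^ n + V ^ n) + U ^ n * V ^ k - U * V ^ k * d"
  note ids = example_net_identities[OF n f e_def]
  have "a * U + b * V \<in> ideal_gen {U, V}" for a b
    unfolding mem_ideal_gen_2 by blast
  then have "f $ i \<in> ideal_gen {U, V}" for i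
    using exhaust_3[of i] by (elim disjE) (simp_all only: ids(1-3))
  with st show "example_net n c d $ i \<in> ideal_gen {Var Var_s, Var Var_t} \<inter> ideal_gen {Var Var_u,
      Var Var_v}" for i
    unfolding vars f_def[symmetric] by blast
  have lin: "a * f $ i - b * f $ j \<in> radical (I_W f)" for a b i j
    unfolding I_W_def ideal_gen_def
    by (intro I_W_subset_radical[unfolded I_W_def ideal_gen_def] ring_module.span_diff
      ring_module.span_scale ring_module.span_base rangeI)
  have n2: "n + n > 0" using \<open>n > 0\<close> by simp
  have V: "S * V \<in> radical (I_W f)" "T * V \<in> radical (I_W f)"
    by (rule radical_mult_power[OF _ n2]; simp only: ids(4,5) lin)+
  have U: "S * U \<in> radical (I_W f)" "T * U \<in> radical (I_W f)"
    by (rule radical_mult_power[OF _ n2]; simp only: ids(6,7); intro radical_add lin radical_mult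
        V)+
  show "Var x * Var z \<in> radical (I_W (example_net n c d))" if "x \<in> {Var_s, Var_t}"
      "z \<in> {Var_u, Var_v}" for x z
    using that U V unfolding f_def S_def T_def U_def V_def by auto
qed

lemma graded_part_mult': "p \<in> graded_part a \<Longrightarrow> q \<in> graded_part b \<Longrightarrow> a + b = c \<Longrightarrow> p * q \<in> graded_part c"
  using graded_part_mult by blast

lemma graded_part_power: "p \<in> graded_part (0, 1) \<Longrightarrow> p ^ k \<in> graded_part (0, int k)"
proof (induction k)
  case 0
  show ?case using Const_graded[of 1] by (simp add: Const_simps)
qed (auto intro: graded_part_mult')

lemma graded_example_net:
  assumes "n > 0" "c \<in> graded_part (0, int (n - 1))" "d \<in> graded_part (0, int (n - 1))"
  shows "graded_vec 1 n (example_net n c d)"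
proof -
  have U: "Var Var_u ^ k \<in> graded_part (0, int k)" and V: "Var Var_v ^ k \<in> graded_part (0, int k)"
      for k
    by (simp_all add: graded_part_power)
  have VX: "Var Var_v * x \<in> graded_part (0, int n)" if "x \<in> graded_part (0, int (n - 1))" for x
    using that \<open>n > 0\<close> by (intro graded_part_mult'[OF Var_graded(4)]) (auto simp: of_nat_diff)
  have *: "Var Var_u ^ n + Var Var_v * c \<in> graded_part (0, int n)"
    "Var Var_v * d \<in> graded_part (0, int n)"
    "Var Var_u ^ (n - 1) * Var Var_v \<in> graded_part (0, int n)"
    "Var Var_u * Var Var_v ^ (n - 1) \<in> graded_part (0, int n)"
    "Var Var_u ^ n + Var Var_v ^ n \<in> graded_part (0, int n)"
    using assms \<open>n > 0\<close>
    by (auto intro!: graded_part_add U V VX intro: graded_part_mult'[OF U Var_graded(4)]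
      graded_part_mult'[OF Var_graded(3) V] simp: of_nat_diff)
  have "Var Var_s * x + Var Var_t * y \<in> graded_part (int 1, int n)"
    if "x \<in> graded_part (0, int n)" "y \<in> graded_part (0, int n)" for x y
    using that by (intro graded_part_add graded_part_mult'[OF Var_graded(1)] graded_part_mult'[OF
        Var_graded(2)]) auto
  then show ?thesis
    unfolding forall_3 example_net_def vector_3 using * V by blast
qed

lemma slice_example_net:
  assumes "dehom c = [:\<gamma>:]" "dehom d = [:\<delta>:]"
  shows "slice 1 (example_net n c d) = vector [monom 1 n + \<gamma>, 1, monom 1 1]"
    "slice 0 (example_net n c d) = vector [\<delta>, monom 1 (n - 1), monom 1 n + 1]"
proof -
  have "dehom (Var Var_u ^ k :: 'a bipoly) = [:monom 1 k:]" for k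
    by (induction k) (simp_all add: monom_Suc one_pCons)
  moreover have dehom_v: "dehom (Var Var_v ^ k :: 'a bipoly) = 1" for k
    by simp
  ultimately have "dehom (example_net n c d $ 1) = [:\<delta>, monom 1 n + \<gamma>:]"
      "dehom (example_net n c d $ 2) = [:monom 1 (n - 1), 1:]"
    "dehom (example_net n c d $ 3) = [:monom 1 n + 1, monom 1 1:]"
    using assms by (simp_all add: example_net_def vector_3 dehom_v one_pCons monom_altdef del:
        dehom_simps(6))
  then show "slice 1 (example_net n c d) = vector [monom 1 n + \<gamma>, 1, monom 1 1]"
    "slice 0 (example_net n c d) = vector [\<delta>, monom 1 (n - 1), monom 1 n + 1]"
    by (simp_all add: vec3_eq_iff vector_3)
qed

text \<open>The coefficient vectors \<open>f\<^sub>0, \<dots>, f\<^sub>n\<close> are independent if the entries of \<open>p\<close> and \<open>q\<close> span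
all polynomials of degree at most \<open>n\<close>. Besides \<open>x\<^sup>n + c\<close>, the fixed entries contribute \<open>1\<close>, \<open>x\<close>,
\<open>x ^ (n - 1)\<close> and \<open>x\<^sup>n + 1\<close>; this leaves out \<open>x\<^sup>2\<close> if \<open>n \<ge> 4\<close> and \<open>x\<^sup>3\<close> if \<open>n = 5\<close>, which are put
into \<open>d\<close> and \<open>c\<close>.\<close>

lemma ex_betti1_3:
  assumes "n \<in> {1, 2, 3, 4, 5}"
  shows "\<exists>W (f :: 'k::field bipoly ^ 3). bpf_subspace n W f \<and> betti1_3 n f = n"
proof -
  have n: "n > 0" using assms by auto
  define \<gamma> \<delta> :: "'k poly" where "\<gamma> = (if n = 5 then monom 1 3 else 0)"
    and "\<delta> = (if n \<ge> 4 then monom 1 2 else 0)"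
  define c d :: "'k bipoly" where "c = (if n = 5 then Var Var_u ^ 3 * Var Var_v else 0)"
    and "d = (if n \<ge> 4 then Var Var_u ^ 2 * Var Var_v ^ (n - 3) else 0)"
  define f where "f = example_net n c d"
  have "dehom (Var Var_u ^ k :: 'k bipoly) = [:monom 1 k:]" for k
    by (induction k) (simp_all add: monom_Suc one_pCons)
  then have cd: "dehom c = [:\<gamma>:]" "dehom d = [:\<delta>:]"
    by (simp_all add: c_def d_def \<gamma>_def \<delta>_def del: dehom_simps(6)) (simp_all)
  have "c \<in> graded_part (0, int (n - 1))"
    by (auto simp: c_def intro!: graded_part_mult'[OF graded_part_power Var_graded(4)])
  moreover have "d \<in> graded_part (0, int (n - 1))"
    by (auto simp: d_def of_nat_diff
      intro!: graded_part_mult'[OF graded_part_power graded_part_power])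
  ultimately have graded: "graded_vec 1 n f"
    unfolding f_def using graded_example_net n by blast
  have bpf: "basepoint_free f"
    unfolding f_def by (rule basepoint_free_example_net[OF n])
  obtain y y' where "bihom_pencil n f y y'"
    using bihom_pencil_of_basepoint_free[OF n graded bpf] by blast
  then interpret bihom_pencil n f y y' .
  have p: "p = vector [monom 1 n + \<gamma>, 1, monom 1 1]" and q:
      "q = vector [\<delta>, monom 1 (n - 1), monom 1 n + 1]"
    unfolding f_def using slice_example_net[OF cd] by blast+
  have "vec.dim (vec.span (f_coeff ` {..n})) = card {..n}"
  proof (rule vec.dim_span_family)
    fix u :: "nat \<Rightarrow> 'k" assume u: "(\<Sum>j\<le>n. u j *s f_coeff j) = 0"
    \<comment> \<open>A relation between the columns \<open>f\<^sub>j\<close> is a linear form on polynomials that kills all entries.\<close>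
    define l where "l r = (\<Sum>j\<le>n. u j * coeff r j)" for r
    have l: "l (a + b) = l a + l b" "l 0 = 0" "m \<le> n \<Longrightarrow> l (monom 1 m) = u m" for a b m
      by (simp_all add: l_def distrib_left sum.distrib if_distrib cong: if_cong)
    have "(\<Sum>j\<le>n. u j * f_coeff j $ x) = 0" for x
      using arg_cong[OF u, of "\<lambda>v. v $ x"] by simp
    from this[of "Inl _"] this[of "Inr _"] have "l (q $ i) = 0" "l (p $ i) = 0" for i
      unfolding l_def f_coeff_def pair_vec_nth vec_coeff_nth by blast+
    then have "l (q $ 1) = 0" "l (q $ 2) = 0" "l (q $ 3) = 0" "l (p $ 1) = 0" "l (p $ 2) = 0"
        "l (p $ 3) = 0"
      by blast+
    then have eqs: "l \<delta> = 0" "u (n - 1) = 0" "u n + u 0 = 0" "u n + l \<gamma> = 0" "u 0 = 0" "u 1 = 0"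
      unfolding p q vector_3 using n by (simp_all add: l flip: monom_eq_1)
    then have "n \<ge> 4 \<Longrightarrow> u 2 = 0" "n = 5 \<Longrightarrow> u 3 = 0"
      by (simp_all add: \<gamma>_def \<delta>_def l)
    moreover have "j = 0 \<or> j = 1 \<or> j = n - 1 \<or> j = n \<or> (j = 2 \<and> n \<ge> 4) \<or> (j = 3 \<and> n = 5)" if
        "j \<le> n" for j
      using that assms by auto
    ultimately show "\<forall>j\<in>{..n}. u j = 0" using eqs by auto
  qed simp
  then have betti: "betti1_3 n f = n" by (simp add: betti1_3_eq)
  define W where "W = poly_space.span (range (($) f))"
  have "poly_space.dim W = card (UNIV :: 3 set)"
    unfolding W_def
  proof (rule poly_space.dim_span_family)
    fix a :: "3 \<Rightarrow> 'k" assume "(\<Sum>i\<in>UNIV. scale_poly (a i) (f $ i)) = 0"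
    then have "dehom (\<Sum>i\<in>UNIV. scale_poly (a i) (f $ i)) = 0" by simp
    then have "(\<Sum>i\<in>UNIV. smult [:a i:] (dehom (f $ i))) = 0"
      by (simp add: dehom_sum scale_poly_def)
    then have "coeff (coeff (\<Sum>i\<in>UNIV. smult [:a i:] (dehom (f $ i))) j) k = 0" for j k by simp
    then have rel: "(\<Sum>i\<in>UNIV. a i * coeff (slice j f $ i) k) = 0" for j k
      by (simp add: coeff_sum)
    have \<gamma>: "coeff \<gamma> n = 0" and \<delta>: "coeff \<delta> n = 0" by (simp_all add: \<gamma>_def \<delta>_def)
    have "n - Suc 0 \<noteq> n" using n by simp
    then have "a 3 = 0"
      using rel[of 0 n] n \<delta> unfolding q sum_3 vector_3 by simp
    moreover from this have "a 1 = 0"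
      using rel[of 1 n] n \<gamma> unfolding p sum_3 vector_3 by simp
    moreover from calculation have "a 2 = 0"
      using rel[of 0 "n - 1"] unfolding q sum_3 vector_3 by simp
    ultimately show "\<forall>i\<in>UNIV. a i = 0" by (simp add: forall_3)
  qed simp
  moreover have "W \<subseteq> graded_part (1, int n)"
    unfolding W_def
  proof (rule poly_space.span_minimal)
    show "range (($) f) \<subseteq> graded_part (1, int n)" using graded by auto
    show "poly_space.subspace (graded_part (1, int n) :: 'k bipoly set)"
      by (rule poly_space.subspaceI)
        (auto simp: scale_poly_def intro: graded_part_add graded_part_mult'[OF Const_graded])
  qed
  ultimately have "bpf_subspace n W f"
    unfolding bpf_subspace_def using bpf by (simp add: W_def)
  with betti show ?thesis by blast
qed

theorem theorem3p3:
  shows "(\<forall>n W (f :: 'k::field bipoly ^ 3). n > 0 \<and> bpf_subspace n W f \<longrightarrow> betti1_3 n f \<in> {1, 2, 3,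
      4, 5}) \<and>
    (\<forall>k \<in> {1, 2, 3, 4, 5}. \<exists>n W (f :: 'k bipoly ^ 3). n > 0 \<and> bpf_subspace n W f \<and> betti1_3 n f =
        k)"
proof (intro conjI allI ballI impI)
  fix n W and f :: "'k bipoly ^ 3"
  assume *: "n > 0 \<and> bpf_subspace n W f"
  then have "range (($) f) \<subseteq> graded_part (1, int n)"
    unfolding bpf_subspace_def using poly_space.span_superset by blast
  then have "graded_vec 1 n f" by auto
  moreover have "basepoint_free f" using * by (simp add: bpf_subspace_def)
  ultimately obtain y y' where "bihom_pencil n f y y'"
    using * bihom_pencil_of_basepoint_free by blast
  then show "betti1_3 n f \<in> {1, 2, 3, 4, 5}"
    by (rule bihom_pencil.betti1_3_bounds)
next
  fix k :: nat assume k: "k \<in> {1, 2, 3, 4, 5}"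
  then have "k > 0" by auto
  then show "\<exists>n W (f :: 'k bipoly ^ 3). n > 0 \<and> bpf_subspace n W f \<and> betti1_3 n f = k"
    using ex_betti1_3[OF k] by blast
qed

end
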